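(* Let $r,u\ge 2$ be integers, $k=r(u-1)$ and $q=(r-1)(u-1)$. Let $\lambda_j$ be the largest zero of $G_j^{(r,u)}(x)$ for $j\ge 1$, and $\lambda_0=-\infty$. Let $\theta$ be a real number in $[-1,u-2+2\sqrt q)$, and let $d\ge 1$ be an integer such that $\lambda_{d-1}<\theta\le\lambda_d$ (such $d$ exists). Then $$h(r,u,\theta)\le 1+\sum_{j=0}^{d-2}kq^j+\frac{kq^{d-1}}{c},\qquad\text{where } c=-\frac{F_d^{(r,u)}(\theta)}{G_{d-1}^{(r,u)}(\theta)}.$$ Equality holds if and only if there is an $r$-regular $u$-uniform generalized Moore geometry of diameter $d$ whose intersection array is $$\begin{pmatrix} * & 1&\cdots&1&c\\ 0&u-2&\cdots&u-2&k-c\\ k&q&\cdots&q&*\end{pmatrix}.$$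
   Context: A hypergraph $H=(V,E)$ consists of a finite vertex set $V$ and a set $E$ of subsets of $V$ (edges), each of size at least 2 (no repeated edges). It is $u$-uniform if every edge has exactly $u$ vertices and $r$-regular if every vertex is in exactly $r$ edges. A walk of length $p$ is a sequence $(x_0,e_1,x_1,\ldots,e_p,x_p)$ of vertices and edges with $x_{i-1},x_i\in e_i$, $x_{i-1}\ne x_i$; $H$ is connected if any two vertices are joined by a walk. The girth is the minimum length of a Berge cycle (a walk with $x_0=x_p$ with all edges distinct and all vertices distinct except $x_0=x_p$); girth at least 3 implies that any two distinct vertices lie in at most one common edge. The adjacency matrix has entries $A_{xy}=|\{e\in E:\{x,y\}\subset e\}|$ for $x\neq y$ and $A_{xx}=0$; the eigenvalues of $H$ are those of $A$, and the second eigenvalue is the second largest one (with multiplicity). The point graph $\Gamma_H$ is the graph on $V$ in which $x\ne y$ are adjacent iff they lie in a common edge. All hypergraphs are assumed connected with girth at least 3. $h(r,u,\theta)$ denotes the maximum order (number of vertices) of such an $r$-regular $u$-uniform hypergraph whose second eigenvalue is at most $\theta$ ($-\infty$ if there is none). Polynomials: $F_0^{(r,u)}=1$, $F_1^{(r,u)}=x$, $F_2^{(r,u)}=x^2-(u-2)x-r(u-1)$, $F_{i+1}^{(r,u)}(x)=(x-u+2)F_i^{(r,u)}(x)-(r-1)(u-1)F_{i-1}^{(r,u)}(x)$ for $i\ge 2$; $G_i^{(r,u)}(x)=\sum_{j=0}^i F_j^{(r,u)}(x)$. An $r$-regular $u$-uniform hypergraph $H$ is a generalized Moore geometry of diameter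 $d$ if $\Gamma_H$ has diameter $d$, any two distinct vertices at distance less than $d$ are joined by a unique shortest path, and any two vertices at distance $d$ are joined by exactly $c$ shortest paths, for a constant $c$. Its intersection array is the displayed one if $\Gamma_H$ is distance-regular with that array: for vertices $x,y$ at distance $i$, the number of neighbours of $y$ at distance $i-1$, $i$, $i+1$ from $x$ is, respectively, $c_i$, $a_i$, $b_i$, where the columns ($i=0,\dots,d$) are $(c_i,a_i,b_i)^T$: $c_i=1$ for $1\le i\le d-1$, $c_d=c$; $a_0=0$, $a_i=u-2$ for $1\le i\le d-1$, $a_d=k-c$; $b_0=k$, $b_i=q$ for $1\le i\le d-1$. *)

theory Defs
  imports
    "Jordan_Normal_Form.Char_Poly"
    "Graph_Theory.Graph_Theory"
    "HOL-Library.Multiset"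
    "HOL-Library.Extended_Nat"
    "HOL-Library.Extended_Real"
begin

section \<open>Hypergraphs\<close>

text \<open>The vertex set is required to be nonempty, so that ``connected'' excludes the null
  hypergraph.\<close>

definition hypergraph :: "'a set \<Rightarrow> 'a set set \<Rightarrow> bool" where
  "hypergraph V E \<longleftrightarrow> finite V \<and> V \<noteq> {} \<and> (\<forall>e\<in>E. e \<subseteq> V \<and> 2 \<le> card e)"

definition uniform_hypergraph :: "nat \<Rightarrow> 'a set set \<Rightarrow> bool" where
  "uniform_hypergraph u E \<longleftrightarrow> (\<forall>e\<in>E. card e = u)"

definition regular_hypergraph :: "nat \<Rightarrow> 'a set \<Rightarrow> 'a set set \<Rightarrow> bool" where
  "regular_hypergraph r V E \<longleftrightarrow> (\<forall>x\<in>V. card {e \<in> E. x \<in> e} = r)"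

text \<open>The walk \<open>(x\<^sub>0, e\<^sub>1, x\<^sub>1, \<dots>, e\<^sub>p, x\<^sub>p)\<close> is given by the list \<open>xs\<close> of its \<open>p + 1\<close> vertices
  and the list \<open>es\<close> of its \<open>p\<close> edges; thus \<open>es ! i\<close> is the edge \<open>e\<^sub>i\<^sub>+\<^sub>1\<close>.\<close>

definition hwalk :: "'a set \<Rightarrow> 'a set set \<Rightarrow> 'a list \<Rightarrow> 'a set list \<Rightarrow> bool" where
  "hwalk V E xs es \<longleftrightarrow>
     length xs = length es + 1 \<and> set xs \<subseteq> V \<and> set es \<subseteq> E \<and>
     (\<forall>i < length es. xs ! i \<in> es ! i \<and> xs ! Suc i \<in> es ! i \<and> xs ! i \<noteq> xs ! Suc i)"

definition connected_hypergraph :: "'a set \<Rightarrow> 'a set set \<Rightarrow> bool" where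
  "connected_hypergraph V E \<longleftrightarrow>
     (\<forall>x\<in>V. \<forall>y\<in>V. \<exists>xs es. hwalk V E xs es \<and> hd xs = x \<and> last xs = y)"

text \<open>The condition \<open>es \<noteq> []\<close> excludes the trivial walk \<open>(x\<^sub>0)\<close>; \<open>distinct (tl xs)\<close> says that
  \<open>x\<^sub>1, \<dots>, x\<^sub>p\<close> are distinct, where \<open>x\<^sub>p = x\<^sub>0\<close>.\<close>

definition berge_cycle :: "'a set \<Rightarrow> 'a set set \<Rightarrow> 'a list \<Rightarrow> 'a set list \<Rightarrow> bool" where
  "berge_cycle V E xs es \<longleftrightarrow>
     hwalk V E xs es \<and> es \<noteq> [] \<and> hd xs = last xs \<and> distinct es \<and> distinct (tl xs)"

text \<open>The girth of a hypergraph without Berge cycles is \<open>\<infinity>\<close>.\<close>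

definition hypergraph_girth :: "'a set \<Rightarrow> 'a set set \<Rightarrow> enat" where
  "hypergraph_girth V E = (INF es \<in> {es. \<exists>xs. berge_cycle V E xs es}. enat (length es))"

text \<open>All hypergraphs under consideration are connected and of girth at least 3.\<close>

definition ru_hypergraph :: "nat \<Rightarrow> nat \<Rightarrow> 'a set \<Rightarrow> 'a set set \<Rightarrow> bool" where
  "ru_hypergraph r u V E \<longleftrightarrow>
     hypergraph V E \<and> connected_hypergraph V E \<and> 3 \<le> hypergraph_girth V E \<and>
     regular_hypergraph r V E \<and> uniform_hypergraph u E"


section \<open>Eigenvalues\<close>

text \<open>Rows and columns are indexed by the vertices in increasing order.\<close>

definition adjacency_matrix :: "'a::linorder set \<Rightarrow> 'a set set \<Rightarrow> real mat" where
  "adjacency_matrix V E =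
     (let vs = sorted_list_of_set V in
      mat (card V) (card V) (\<lambda>(i, j).
        if vs ! i = vs ! j then 0 else real (card {e \<in> E. {vs ! i, vs ! j} \<subseteq> e})))"

text \<open>Eigenvalues are counted with multiplicity, as roots of the characteristic polynomial. The
  definition is meaningful for hypergraphs with at least two vertices.\<close>

definition second_eigenvalue :: "'a::linorder set \<Rightarrow> 'a set set \<Rightarrow> real" where
  "second_eigenvalue V E =
     rev (sorted_list_of_multiset (proots (char_poly (adjacency_matrix V E)))) ! 1"

text \<open>Every finite hypergraph is isomorphic to one whose vertices are natural numbers. The supremum
  in \<^typ>\<open>ereal\<close> is \<open>-\<infinity>\<close> if there is no such hypergraph; otherwise it is the maximum order as soon
  as the orders are bounded.\<close>

definition max_order :: "nat \<Rightarrow> nat \<Rightarrow> real \<Rightarrow> ereal" where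
  "max_order r u \<theta> =
     Sup {ereal (real (card V)) | (V :: nat set) E.
            ru_hypergraph r u V E \<and> second_eigenvalue V E \<le> \<theta>}"


section \<open>The polynomials\<close>

fun F_poly :: "nat \<Rightarrow> nat \<Rightarrow> nat \<Rightarrow> real poly" where
  "F_poly r u 0 = 1"
| "F_poly r u (Suc 0) = [:0, 1:]"
| "F_poly r u (Suc (Suc 0)) = [:- (real r * (real u - 1)), - (real u - 2), 1:]"
| "F_poly r u (Suc (Suc (Suc i))) =
     [:- (real u - 2), 1:] * F_poly r u (Suc (Suc i))
     - Polynomial.smult ((real r - 1) * (real u - 1)) (F_poly r u (Suc i))"

definition G_poly :: "nat \<Rightarrow> nat \<Rightarrow> nat \<Rightarrow> real poly" where
  "G_poly r u i = (\<Sum>j\<le>i. F_poly r u j)"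

definition largest_zero_G :: "nat \<Rightarrow> nat \<Rightarrow> nat \<Rightarrow> ereal" where
  "largest_zero_G r u j =
     (if j = 0 then -\<infinity> else ereal (Max {x. poly (G_poly r u j) x = 0}))"


section \<open>Point graphs and generalized Moore geometries\<close>

definition point_graph :: "'a set \<Rightarrow> 'a set set \<Rightarrow> ('a, 'a \<times> 'a) pre_digraph" where
  "point_graph V E =
     with_proj \<lparr> pverts = V,
                 parcs = {(x, y). x \<in> V \<and> y \<in> V \<and> x \<noteq> y \<and> (\<exists>e\<in>E. x \<in> e \<and> y \<in> e)} \<rparr>"

definition graph_dist :: "('a, 'b) pre_digraph \<Rightarrow> 'a \<Rightarrow> 'a \<Rightarrow> enat" where
  "graph_dist G x y = (INF p \<in> {p. vwalk p G \<and> hd p = x \<and> last p = y}. enat (vwalk_length p))"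

definition graph_diameter :: "('a, 'b) pre_digraph \<Rightarrow> enat" where
  "graph_diameter G = (SUP x \<in> verts G. SUP y \<in> verts G. graph_dist G x y)"

definition shortest_paths :: "('a, 'b) pre_digraph \<Rightarrow> 'a \<Rightarrow> 'a \<Rightarrow> 'a list set" where
  "shortest_paths G x y =
     {p. vpath p G \<and> hd p = x \<and> last p = y \<and> enat (vwalk_length p) = graph_dist G x y}"

text \<open>In a hypergraph of girth at least 3 two adjacent points lie in exactly one common edge, so
  shortest paths in the point graph are the same as shortest paths in the hypergraph.\<close>

definition generalized_moore_geometry ::
    "nat \<Rightarrow> nat \<Rightarrow> nat \<Rightarrow> 'a set \<Rightarrow> 'a set set \<Rightarrow> bool" where
  "generalized_moore_geometry r u d V E \<longleftrightarrow>
     ru_hypergraph r u V E \<and>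
     graph_diameter (point_graph V E) = enat d \<and>
     (\<forall>x\<in>V. \<forall>y\<in>V. x \<noteq> y \<and> graph_dist (point_graph V E) x y < enat d \<longrightarrow>
        (\<exists>!p. p \<in> shortest_paths (point_graph V E) x y)) \<and>
     (\<exists>c. \<forall>x\<in>V. \<forall>y\<in>V. graph_dist (point_graph V E) x y = enat d \<longrightarrow>
        card (shortest_paths (point_graph V E) x y) = c)"

text \<open>The entries \<open>c 0\<close> and \<open>b d\<close> are the ones displayed as \<open>*\<close> and are irrelevant.\<close>

definition distance_regular_with_array ::
    "('a, 'b) pre_digraph \<Rightarrow> nat \<Rightarrow> (nat \<Rightarrow> real) \<Rightarrow> (nat \<Rightarrow> real) \<Rightarrow> (nat \<Rightarrow> real) \<Rightarrow> bool" where
  "distance_regular_with_array G d c a b \<longleftrightarrow>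
     graph_diameter G = enat d \<and>
     (\<forall>x\<in>verts G. \<forall>y\<in>verts G. \<forall>i\<le>d. graph_dist G x y = enat i \<longrightarrow>
        (1 \<le> i \<longrightarrow> real (card {z. (y, z) \<in> arcs_ends G \<and> graph_dist G x z = enat (i - 1)}) = c i) \<and>
        real (card {z. (y, z) \<in> arcs_ends G \<and> graph_dist G x z = enat i}) = a i \<and>
        (i < d \<longrightarrow> real (card {z. (y, z) \<in> arcs_ends G \<and> graph_dist G x z = enat (i + 1)}) = b i))"

end

theory Submission
  imports Defs "Jordan_Normal_Form.Schur_Decomposition"
begin

text \<open>
  Let \<open>A\<close> be the adjacency matrix of a hypergraph with \<open>n\<close> vertices. The entries of \<open>F\<^sub>i(A)\<close> count the
  walks of length \<open>i\<close> in which consecutive edges differ, so they are nonnegative integers. Put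
  \<open>P = F\<^sub>d + c G\<^sub>d\<^sub>-\<^sub>1\<close>, which vanishes at \<open>\<theta>\<close>. By the Christoffel-Darboux formula for the \<open>G\<^sub>i\<close>, the
  quotient \<open>g = P / (x - \<theta>)\<close> is a combination of \<open>F\<^sub>0, \<dots>, F\<^sub>d\<^sub>-\<^sub>1\<close> with positive coefficients.
  If the second eigenvalue is at most \<open>\<theta>\<close>, then \<open>P g = (x - \<theta>) g\<^sup>2\<close> is nonpositive at all eigenvalues
  but \<open>k\<close>, so \<open>tr P(A) g(A) \<le> P(k) g(k)\<close>; as \<open>m\<^sup>2 \<ge> m\<close> for integers \<open>m\<close>, also
  \<open>tr P(A) g(A) \<ge> c n g(k)\<close>. Hence \<open>n \<le> P(k) / c\<close>, which is the bound. Equality forces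
  \<open>P(\<lambda>) = 0\<close> for all eigenvalues \<open>\<lambda>\<close> but \<open>k\<close>, and this means that all entries of \<open>P(A)\<close> equal \<open>c\<close>: two
  vertices are joined either by exactly one walk of some length less than \<open>d\<close> or by \<open>c\<close> walks of
  length \<open>d\<close>, which is the asserted distance regularity.
\<close>

section \<open>Traces of powers of real symmetric matrices\<close>

lemma upper_triangular_mult:
  fixes A B :: "'a::comm_semiring_1 mat"
  assumes "A \<in> carrier_mat n n" "B \<in> carrier_mat n n" "upper_triangular A" "upper_triangular B"
  shows "upper_triangular (A * B)"
    and "i < n \<Longrightarrow> (A * B) $$ (i, i) = A $$ (i, i) * B $$ (i, i)"
proof -
  have entry: "(A * B) $$ (i, j) = (\<Sum>l<n. A $$ (i, l) * B $$ (l, j))" if "i < n" "j < n" for i j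
    using assms that by (simp add: scalar_prod_def atLeast0LessThan)
  show "upper_triangular (A * B)"
  proof
    fix i j assume ij: "j < i" "i < dim_row (A * B)"
    have "A $$ (i, l) * B $$ (l, j) = 0" if "l < n" for l
      using assms ij that by (cases "l < i") (auto simp: upper_triangularD)
    then show "(A * B) $$ (i, j) = 0" using ij assms entry[of i j] by simp
  qed
  show "(A * B) $$ (i, i) = A $$ (i, i) * B $$ (i, i)" if i: "i < n"
  proof -
    have "(\<Sum>l<n. A $$ (i, l) * B $$ (l, i)) = (\<Sum>l\<in>{i}. A $$ (i, l) * B $$ (l, i))"
    proof (rule sum.mono_neutral_right)
      show "\<forall>l\<in>{..<n} - {i}. A $$ (i, l) * B $$ (l, i) = 0"
      proof
        fix l assume "l \<in> {..<n} - {i}"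
        then show "A $$ (i, l) * B $$ (l, i) = 0"
          using assms i by (cases "l < i") (auto simp: upper_triangularD)
      qed
    qed (use i in auto)
    then show ?thesis using i entry[of i i] by simp
  qed
qed

lemma upper_triangular_pow:
  fixes B :: "'a::comm_semiring_1 mat"
  assumes B: "B \<in> carrier_mat n n" "upper_triangular B"
  shows "upper_triangular (B ^\<^sub>m m) \<and> (\<forall>i<n. (B ^\<^sub>m m) $$ (i, i) = (B $$ (i, i)) ^ m)"
proof (induction m)
  case (Suc m)
  then show ?case
    using upper_triangular_mult[of "B ^\<^sub>m m" n B] B by (simp add: mult.commute)
qed (use B in auto)

lemma trace_mult_commute:
  fixes A B :: "'a::comm_semiring_1 mat"
  assumes "A \<in> carrier_mat n n" "B \<in> carrier_mat n n"
  shows "(\<Sum>i<n. (A * B) $$ (i, i)) = (\<Sum>i<n. (B * A) $$ (i, i))"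
proof -
  have "(\<Sum>i<n. (A * B) $$ (i, i)) = (\<Sum>i<n. \<Sum>l<n. A $$ (i, l) * B $$ (l, i))"
    using assms by (simp add: scalar_prod_def atLeast0LessThan)
  also have "\<dots> = (\<Sum>l<n. \<Sum>i<n. A $$ (i, l) * B $$ (l, i))"
    by (rule sum.swap)
  also have "\<dots> = (\<Sum>i<n. (B * A) $$ (i, i))"
    using assms by (simp add: scalar_prod_def atLeast0LessThan mult.commute)
  finally show ?thesis .
qed

lemma trace_pow_factored_char_poly:
  fixes A :: "'a::conjugatable_ordered_field mat"
  assumes A: "A \<in> carrier_mat n n" and cp: "char_poly A = (\<Prod>a\<leftarrow>as. [:- a, 1:])"
  shows "(\<Sum>i<n. (A ^\<^sub>m m) $$ (i, i)) = (\<Sum>a\<leftarrow>as. a ^ m)"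
proof -
  obtain B P Q where dec: "schur_decomposition A as = (B, P, Q)"
    by (cases "schur_decomposition A as") auto
  from schur_decomposition[OF A cp dec]
  have wit: "similar_mat_wit A B P Q" and ut: "upper_triangular B" and diag: "diag_mat B = as"
    by auto
  from similar_mat_witD2[OF A wit]
  have B: "B \<in> carrier_mat n n" and P: "P \<in> carrier_mat n n" and Q: "Q \<in> carrier_mat n n"
    and QP: "Q * P = 1\<^sub>m n" by auto
  have Bm: "B ^\<^sub>m m \<in> carrier_mat n n" using B by simp
  have "Q * (P * B ^\<^sub>m m) = B ^\<^sub>m m"
    using assoc_mult_mat[OF Q P Bm] QP left_mult_one_mat[OF Bm] by simp
  then have "(\<Sum>i<n. (A ^\<^sub>m m) $$ (i, i)) = (\<Sum>i<n. (B ^\<^sub>m m) $$ (i, i))"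
    using similar_mat_wit_pow_id[OF wit, of m] trace_mult_commute[of "P * B ^\<^sub>m m" n Q] P Q Bm
    by simp
  also have "\<dots> = (\<Sum>i<n. (B $$ (i, i)) ^ m)"
    using upper_triangular_pow[OF B ut] by simp
  also have "\<dots> = (\<Sum>a\<leftarrow>as. a ^ m)"
    using B by (simp flip: diag add: diag_mat_def comp_def sum_list_distinct_conv_sum_set atLeast0LessThan)
  finally show ?thesis .
qed

lemma eigenvalue_of_real_symmetric:
  fixes A :: "real mat"
  assumes A: "A \<in> carrier_mat n n" and sym: "\<And>i j. i < n \<Longrightarrow> j < n \<Longrightarrow> A $$ (i, j) = A $$ (j, i)"
    and ev: "eigenvalue (map_mat complex_of_real A) z"
  shows "z \<in> \<real>"
proof -
  from ev A obtain v where v: "v \<in> carrier_vec n" "v \<noteq> 0\<^sub>v n"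
    and eq: "map_mat complex_of_real A *\<^sub>v v = z \<cdot>\<^sub>v v"
    unfolding eigenvalue_def eigenvector_def by auto
  have row: "(\<Sum>j<n. complex_of_real (A $$ (i, j)) * v $ j) = z * v $ i" if "i < n" for i
  proof -
    have "(map_mat complex_of_real A *\<^sub>v v) $ i = (\<Sum>j<n. complex_of_real (A $$ (i, j)) * v $ j)"
      using A v that by (simp add: scalar_prod_def atLeast0LessThan)
    then show ?thesis using eq v that by simp
  qed
  define S where "S = (\<Sum>i<n. v $ i * cnj (v $ i))"
  define T where "T = (\<Sum>i<n. \<Sum>j<n. complex_of_real (A $$ (i, j)) * v $ j * cnj (v $ i))"
  have T: "T = z * S"
    by (simp add: T_def S_def row sum_distrib_left flip: sum_distrib_right mult.assoc)
  have "cnj T = (\<Sum>i<n. \<Sum>j<n. complex_of_real (A $$ (j, i)) * v $ i * cnj (v $ j))"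
    unfolding T_def cnj_sum by (intro sum.cong refl) (simp add: sym)
  also have "\<dots> = T" unfolding T_def by (rule sum.swap)
  finally have "cnj z * cnj S = z * S" using T by simp
  moreover have S: "S = complex_of_real (\<Sum>i<n. (cmod (v $ i))\<^sup>2)"
    unfolding S_def of_real_sum complex_norm_square ..
  moreover have "S \<noteq> 0"
  proof
    assume "S = 0"
    then have "(\<Sum>i<n. (cmod (v $ i))\<^sup>2) = 0" using S of_real_eq_0_iff by metis
    then have "\<forall>i<n. v $ i = 0" by (subst (asm) sum_nonneg_eq_0_iff) auto
    with v show False by auto
  qed
  ultimately have "cnj z = z" by simp
  then show ?thesis using Reals_cnj_iff by blast
qed

lemma char_poly_real_symmetric_factored:
  fixes A :: "real mat"
  assumes A: "A \<in> carrier_mat n n" and sym: "\<And>i j. i < n \<Longrightarrow> j < n \<Longrightarrow> A $$ (i, j) = A $$ (j, i)"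
  shows "\<exists>as. char_poly A = (\<Prod>a\<leftarrow>as. [:- a, 1:]) \<and> length as = n"
proof -
  let ?C = "map_mat complex_of_real A"
  have C: "?C \<in> carrier_mat n n" using A by simp
  obtain zs where zs: "char_poly ?C = (\<Prod>z\<leftarrow>zs. [:- z, 1:])" "length zs = n"
    using char_poly_factorized[OF C] by blast
  have "z \<in> \<real>" if "z \<in> set zs" for z
  proof -
    have "poly (char_poly ?C) z = 0"
      using that unfolding zs(1) poly_prod_list prod_list_zero_iff by force
    then show ?thesis
      using eigenvalue_of_real_symmetric[OF A sym] eigenvalue_root_char_poly[OF C] by blast
  qed
  then have eq: "zs = map complex_of_real (map Re zs)"
    by (auto intro!: nth_equalityI simp: nth_mem)
  interpret h: map_poly_inj_comm_ring_hom complex_of_real ..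
  have "map_poly complex_of_real (char_poly A) = char_poly ?C"
    by (rule of_real_hom.char_poly_hom[OF A, symmetric])
  also have "\<dots> = map_poly complex_of_real (\<Prod>a\<leftarrow>map Re zs. [:- a, 1:])"
    unfolding zs(1) h.hom_prod_list by (subst eq) (simp add: comp_def)
  finally have "char_poly A = (\<Prod>a\<leftarrow>map Re zs. [:- a, 1:])" by simp
  with zs(2) show ?thesis by (intro exI[of _ "map Re zs"]) simp
qed

lemma proots_char_poly_real_symmetric:
  fixes A :: "real mat"
  assumes A: "A \<in> carrier_mat n n" and sym: "\<And>i j. i < n \<Longrightarrow> j < n \<Longrightarrow> A $$ (i, j) = A $$ (j, i)"
  shows "size (proots (char_poly A)) = n"
    and "(\<Sum>i<n. (A ^\<^sub>m m) $$ (i, i)) = (\<Sum>a\<in>#proots (char_poly A). a ^ m)"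
proof -
  obtain as where as: "char_poly A = (\<Prod>a\<leftarrow>as. [:- a, 1:])" "length as = n"
    using char_poly_real_symmetric_factored[OF assms] by blast
  have "(\<Prod>a\<leftarrow>bs. [:- a, 1:]) \<noteq> 0" for bs :: "real list"
    by (auto simp: prod_list_zero_iff)
  then have proots: "proots (char_poly A) = mset as"
    unfolding as(1) by (induction as) (simp_all add: proots_mult del: mult_pCons_left)
  show "size (proots (char_poly A)) = n" by (simp add: proots as(2))
  show "(\<Sum>i<n. (A ^\<^sub>m m) $$ (i, i)) = (\<Sum>a\<in>#proots (char_poly A). a ^ m)"
    unfolding trace_pow_factored_char_poly[OF A as(1)] proots by (simp flip: sum_mset_sum_list)
qed

section \<open>The polynomials\<close>

lemma poly_root_above:
  fixes p :: "real poly"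
  assumes "0 < lead_coeff p" and "poly p x < 0"
  shows "\<exists>y>x. poly p y = 0"
proof -
  obtain b where b: "\<And>y. b \<le> y \<Longrightarrow> lead_coeff p \<le> poly p y"
    using poly_pinfty_gt_lc[OF assms(1)] by blast
  have "0 < poly p (max b (x + 1))"
    using b[of "max b (x + 1)"] assms(1) by simp
  then show ?thesis
    using poly_IVT_pos[of x "max b (x + 1)" p] assms(2) by fastforce
qed

lemma poly_pos_above_Max_root:
  fixes p :: "real poly"
  assumes "0 < lead_coeff p" and "Max {x. poly p x = 0} < x"
  shows "0 < poly p x"
proof (rule ccontr)
  assume neg: "\<not> 0 < poly p x"
  have fin: "finite {x. poly p x = 0}"
    using assms(1) by (intro poly_roots_finite) auto
  have "\<exists>y\<ge>x. poly p y = 0"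
    using poly_root_above[OF assms(1), of x] neg by (meson less_eq_real_def not_less)
  then obtain y where "x \<le> y" "poly p y = 0" by blast
  with Max_ge[OF fin, of y] assms(2) show False by simp
qed

locale ru_params =
  fixes r u :: nat and k q :: real
  assumes r2: "2 \<le> r" and u2: "2 \<le> u"
    and k_def: "k = real r * (real u - 1)"
    and q_def: "q = (real r - 1) * (real u - 1)"
begin

abbreviation "F \<equiv> F_poly r u"
abbreviation "G \<equiv> G_poly r u"
abbreviation "lz \<equiv> largest_zero_G r u"

lemma q_ge_1: "1 \<le> q"
proof -
  have "1 * 1 \<le> (real r - 1) * (real u - 1)"
    using r2 u2 by (intro mult_mono) auto
  then show ?thesis by (simp add: q_def)
qed

lemma k_eq: "k = q + (real u - 1)"
  by (simp add: k_def q_def algebra_simps)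

lemma F_2: "F 2 = [:- k, - (real u - 2), 1:]"
  by (simp add: numeral_2_eq_2 k_def)

lemma F_rec: "1 \<le> i \<Longrightarrow> F (Suc (Suc i)) = [:- (real u - 2), 1:] * F (Suc i) - Polynomial.smult q (F i)"
  by (cases i) (simp_all add: q_def)

lemma G_0: "G 0 = 1" and G_1: "G (Suc 0) = [:1, 1:]" and G_Suc: "G (Suc i) = G i + F (Suc i)"
  by (simp_all add: G_poly_def one_pCons)

lemma G_rec: "G (Suc (Suc i)) = [:- (real u - 2), 1:] * G (Suc i) - Polynomial.smult q (G i)"
proof (induction i)
  case 0
  show ?case using F_2 by (simp add: G_Suc[of "Suc 0"] G_0 G_1 numeral_2_eq_2 k_eq)
next
  case (Suc i)
  define X where "X = [:- (real u - 2), 1:]"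
  have "F (Suc (Suc (Suc i))) = X * (G (Suc (Suc i)) - G (Suc i))
      - Polynomial.smult q (G (Suc i) - G i)"
    by (subst F_rec) (simp_all only: X_def G_Suc[of "Suc i"] G_Suc[of i], simp_all)
  moreover have "Polynomial.smult q (G i) = X * G (Suc i) - G (Suc (Suc i))"
    unfolding X_def Suc.IH by simp
  ultimately have "G (Suc (Suc (Suc i))) = X * G (Suc (Suc i)) - Polynomial.smult q (G (Suc i))"
    by (simp add: G_Suc[of "Suc (Suc i)"] algebra_simps smult_diff_right del: F_poly.simps)
  then show ?case by (simp only: X_def)
qed

lemma poly_G_rec: "poly (G (Suc (Suc i))) x = (x - (real u - 2)) * poly (G (Suc i)) x - q * poly (G i) x"
  unfolding G_rec by (simp add: algebra_simps)

lemma G_monic: "degree (G i) = i \<and> lead_coeff (G i) = 1"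
proof (induction i rule: induct_nat_012)
  case (ge2 i)
  let ?p = "[:- (real u - 2), 1:] * G (Suc i)"
  have lc1: "coeff (G (Suc i)) (Suc i) = 1" using ge2(2) by metis
  then have ne: "G (Suc i) \<noteq> 0" by auto
  have deg: "degree ?p = Suc (Suc i)" using ge2 ne by (subst degree_mult_eq) (auto simp del: mult_pCons_left)
  have lc: "lead_coeff ?p = 1" using ge2(2) lc1 unfolding lead_coeff_mult by simp
  have lt: "degree (Polynomial.smult q (G i)) < degree ?p"
    using deg ge2 degree_smult_le[of q "G i"] by linarith
  have "degree (?p - Polynomial.smult q (G i)) = degree ?p"
    using lt by (metis degree_add_eq_left degree_minus uminus_add_conv_diff add.commute)
  moreover have "coeff (Polynomial.smult q (G i)) (Suc (Suc i)) = 0"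
    using lt deg by (intro coeff_eq_0) linarith
  ultimately show ?case using deg lc by (simp only: G_rec coeff_diff) simp
qed (simp_all add: G_0 G_1)

lemma Christoffel_Darboux:
  "poly (G (Suc i)) x * poly (G i) y - poly (G i) x * poly (G (Suc i)) y
     = (x - y) * (\<Sum>j\<le>i. q ^ (i - j) * poly (G j) x * poly (G j) y)"
proof (induction i)
  case 0
  show ?case by (simp add: G_0 G_1)
next
  case (Suc i)
  have "(\<Sum>j\<le>Suc i. q ^ (Suc i - j) * poly (G j) x * poly (G j) y)
      = q * (\<Sum>j\<le>i. q ^ (i - j) * poly (G j) x * poly (G j) y)
        + poly (G (Suc i)) x * poly (G (Suc i)) y"
    by (simp add: sum_distrib_left Suc_diff_le mult.assoc)
  moreover have "poly (G (Suc (Suc i))) x * poly (G (Suc i)) y - poly (G (Suc i)) x * poly (G (Suc (Suc i))) y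
      = q * (poly (G (Suc i)) x * poly (G i) y - poly (G i) x * poly (G (Suc i)) y)
        + (x - y) * (poly (G (Suc i)) x * poly (G (Suc i)) y)"
    by (simp add: poly_G_rec algebra_simps)
  ultimately show ?case
    unfolding Suc.IH by (simp add: algebra_simps)
qed

lemma G_pos: "lz j < ereal x \<Longrightarrow> 0 < poly (G j) x"
  using poly_pos_above_Max_root[of "G j" x] G_monic[of j]
  by (cases "j = 0") (auto simp: largest_zero_G_def G_0)

lemma lz_root: "\<exists>z. lz (Suc j) = ereal z \<and> poly (G (Suc j)) z = 0 \<and> lz j < ereal z"
proof (induction j)
  case 0
  have "{x. poly (G (Suc 0)) x = 0} = {-1}" by (auto simp: G_1)
  then show ?case by (auto simp: largest_zero_G_def G_1)
next
  case (Suc j)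
  then obtain z where z: "lz (Suc j) = ereal z" "poly (G (Suc j)) z = 0" "lz j < ereal z"
    by blast
  let ?Z = "{x. poly (G (Suc (Suc j))) x = 0}"
  have "poly (G (Suc (Suc j))) z < 0"
    using G_pos[OF z(3)] q_ge_1 by (simp add: poly_G_rec z(2))
  then obtain y where y: "y > z" "y \<in> ?Z"
    using poly_root_above[of "G (Suc (Suc j))" z] G_monic[of "Suc (Suc j)"] by auto
  have fin: "finite ?Z"
    using G_monic[of "Suc (Suc j)"] by (intro poly_roots_finite) force
  have "Max ?Z \<in> ?Z" using fin y by (intro Max_in) auto
  moreover have "z < Max ?Z" using Max_ge[OF fin y(2)] y(1) by linarith
  ultimately show ?case by (auto simp: largest_zero_G_def[of _ _ "Suc (Suc j)"] z(1))
qed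

lemma lz_less_Suc: "lz j < lz (Suc j)"
  using lz_root[of j] by auto

lemma lz_mono: "i \<le> j \<Longrightarrow> lz i \<le> lz j"
  by (rule lift_Suc_mono_le[of lz]) (simp_all add: less_imp_le lz_less_Suc)

lemma G_nonpos:
  assumes "lz j < ereal \<theta>" and "ereal \<theta> \<le> lz (Suc j)"
  shows "poly (G (Suc j)) \<theta> \<le> 0"
proof -
  obtain z where z: "lz (Suc j) = ereal z" "poly (G (Suc j)) z = 0" using lz_root[of j] by blast
  have pos: "0 < poly (G i) x" if "i \<le> j" "\<theta> \<le> x" for i x
    using that assms(1) lz_mono[OF that(1)] by (intro G_pos) (metis ereal_less_eq(3) le_less_trans less_le_trans)
  have "\<theta> \<le> z" using assms z by simp
  then have "- (poly (G j) z * poly (G (Suc j)) \<theta>) \<ge> 0"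
    using Christoffel_Darboux[of j z \<theta>] q_ge_1
    by (auto simp: z(2) intro!: mult_nonneg_nonneg sum_nonneg less_imp_le[OF pos])
  moreover have "0 < poly (G j) z" using \<open>\<theta> \<le> z\<close> by (intro pos) auto
  ultimately show ?thesis by (simp add: mult_le_0_iff)
qed

text \<open>If all \<open>G\<^sub>i(\<theta>)\<close> were positive, their ratios would decrease by at least
  \<open>2 \<surd>q - (\<theta> - u + 2)\<close> in each step.\<close>

lemma ex_G_nonpos:
  assumes "\<theta> < real u - 2 + 2 * sqrt q"
  shows "\<exists>i. poly (G i) \<theta> \<le> 0"
proof (rule ccontr)
  assume "\<nexists>i. poly (G i) \<theta> \<le> 0"
  then have pos: "0 < poly (G i) \<theta>" for i by (simp add: not_le)
  define s where "s = \<theta> - (real u - 2)"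
  define \<rho> where "\<rho> i = poly (G (Suc i)) \<theta> / poly (G i) \<theta>" for i
  have \<rho>_pos: "0 < \<rho> i" for i by (simp add: \<rho>_def pos)
  have step: "\<rho> (Suc i) \<le> \<rho> i - (2 * sqrt q - s)" for i
  proof -
    have "\<rho> (Suc i) = s - q / \<rho> i"
      using pos[of i] pos[of "Suc i"] by (simp add: \<rho>_def poly_G_rec s_def field_simps)
    moreover have "2 * sqrt q \<le> \<rho> i + q / \<rho> i"
    proof -
      have "0 \<le> (\<rho> i - sqrt q)\<^sup>2" by simp
      also have "\<dots> = \<rho> i * (\<rho> i + q / \<rho> i - 2 * sqrt q)"
        using \<rho>_pos[of i] q_ge_1 by (simp add: power2_eq_square algebra_simps)
      finally show ?thesis using \<rho>_pos[of i] by (simp add: zero_le_mult_iff)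
    qed
    ultimately show ?thesis by simp
  qed
  have bound: "\<rho> i \<le> \<rho> 0 - real i * (2 * sqrt q - s)" for i
  proof (induction i)
    case (Suc i)
    with step[of i] show ?case by (simp add: algebra_simps)
  qed simp
  have "0 < 2 * sqrt q - s" using assms by (simp add: s_def)
  then obtain i where "\<rho> 0 < real i * (2 * sqrt q - s)"
    using reals_Archimedean3 by blast
  with bound[of i] \<rho>_pos[of i] show False by simp
qed

lemma ex_interval:
  assumes "\<theta> < real u - 2 + 2 * sqrt q"
  shows "\<exists>d\<ge>1. lz (d - 1) < ereal \<theta> \<and> ereal \<theta> \<le> lz d"
proof -
  obtain i where "poly (G i) \<theta> \<le> 0" using ex_G_nonpos[OF assms] by blast
  then have i: "ereal \<theta> \<le> lz i" using G_pos[of i \<theta>] by force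
  define d where "d = (LEAST d. ereal \<theta> \<le> lz d)"
  have d: "ereal \<theta> \<le> lz d" unfolding d_def using i by (rule LeastI)
  have "d \<noteq> 0" using d by (auto simp: largest_zero_G_def intro!: gr0I)
  then have "\<not> ereal \<theta> \<le> lz (d - 1)"
    using not_less_Least[of "d - 1" "\<lambda>d. ereal \<theta> \<le> lz d"] by (simp flip: d_def)
  with d \<open>d \<noteq> 0\<close> show ?thesis by (intro exI[of _ d]) auto
qed

lemma poly_F_k: "poly (F (Suc i)) k = k * q ^ i"
proof (induction i rule: induct_nat_012)
  case 1
  show ?case using F_2 by (simp add: numeral_2_eq_2 k_eq algebra_simps)
next
  case (ge2 i)
  have "poly (F (Suc (Suc (Suc i)))) k = (k - (real u - 2)) * (k * q ^ Suc i) - q * (k * q ^ i)"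
    by (subst F_rec) (use ge2 in \<open>simp_all add: algebra_simps\<close>)
  then show ?case by (simp add: k_eq algebra_simps)
qed simp

lemma poly_G_k: "poly (G i) k = 1 + (\<Sum>j<i. k * q ^ j)"
  by (induction i) (simp_all add: G_0 G_Suc poly_F_k)

lemma theta_less_k: "\<theta> < real u - 2 + 2 * sqrt q \<Longrightarrow> \<theta> < k"
proof -
  assume "\<theta> < real u - 2 + 2 * sqrt q"
  moreover have "0 \<le> (sqrt q - 1)\<^sup>2" by simp
  then have "2 * sqrt q \<le> q + 1" using q_ge_1 by (simp add: power2_eq_square algebra_simps)
  ultimately show ?thesis by (simp add: k_eq)
qed

lemma moore_polynomial:
  assumes "1 \<le> d" "lz (d - 1) < ereal \<theta>" "ereal \<theta> \<le> lz d"
    and c: "c = - (poly (F d) \<theta> / poly (G (d - 1)) \<theta>)"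
  obtains g h where "0 < c"
    and "F d + Polynomial.smult c (G (d - 1)) = [:- \<theta>, 1:] * g"
    and "g = (\<Sum>j<d. Polynomial.smult (h j) (F j))"
    and "\<And>j. j < d \<Longrightarrow> 0 < h j"
    and "\<And>x. \<theta> < x \<Longrightarrow> 0 < poly g x"
proof -
  obtain e where d: "d = Suc e" using assms(1) by (cases d) auto
  have lz: "lz e < ereal \<theta>" "ereal \<theta> \<le> lz (Suc e)" using assms(2,3) d by auto
  have pos: "0 < poly (G i) x" if "i \<le> e" "\<theta> \<le> x" for i x
    using that lz(1) lz_mono[OF that(1)] by (intro G_pos) (metis ereal_less_eq(3) le_less_trans less_le_trans)
  note pos\<theta> = pos[OF _ order_refl]
  have c': "c = 1 - poly (G d) \<theta> / poly (G e) \<theta>"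
    using pos\<theta>[of e] by (simp add: c d G_Suc field_simps)
  have "0 < c"
    using G_nonpos[OF lz] pos\<theta>[of e] by (simp add: c' d add_pos_nonneg field_simps)
  define w where "w i = q ^ (e - i) * poly (G i) \<theta> / poly (G e) \<theta>" for i
  have w: "0 < w i" if "i \<le> e" for i
    using pos\<theta>[OF that] pos\<theta>[of e] q_ge_1 by (simp add: w_def)
  define g where "g = (\<Sum>i\<le>e. Polynomial.smult (w i) (G i))"
  define h where "h j = (\<Sum>i\<in>{j..e}. w i)" for j
  have "F d + Polynomial.smult c (G (d - 1)) = [:- \<theta>, 1:] * g"
  proof (rule poly_ext)
    fix x
    have "poly (F d + Polynomial.smult c (G (d - 1))) x
        = (poly (G d) x * poly (G e) \<theta> - poly (G e) x * poly (G d) \<theta>) / poly (G e) \<theta>"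
      using pos\<theta>[of e] by (simp add: c' d G_Suc field_simps)
    also have "\<dots> = (x - \<theta>) * poly g x"
    proof -
      have "poly g x = (\<Sum>j\<le>e. q ^ (e - j) * poly (G j) x * poly (G j) \<theta>) / poly (G e) \<theta>"
        unfolding g_def poly_sum sum_divide_distrib by (intro sum.cong) (simp_all add: w_def)
      then show ?thesis unfolding d Christoffel_Darboux by simp
    qed
    finally show "poly (F d + Polynomial.smult c (G (d - 1))) x = poly ([:- \<theta>, 1:] * g) x"
      by (simp add: algebra_simps)
  qed
  moreover have "g = (\<Sum>j<d. Polynomial.smult (h j) (F j))"
  proof -
    have "g = (\<Sum>i\<in>{..e}. \<Sum>j | j \<in> {..e} \<and> j \<le> i. Polynomial.smult (w i) (F j))"
      unfolding g_def G_poly_def smult_sum2 by (intro sum.cong) auto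
    also have "\<dots> = (\<Sum>j\<in>{..e}. \<Sum>i | i \<in> {..e} \<and> j \<le> i. Polynomial.smult (w i) (F j))"
      by (rule sum.swap_restrict) auto
    also have "\<dots> = (\<Sum>j<d. Polynomial.smult (h j) (F j))"
      unfolding d lessThan_Suc_atMost h_def smult_sum by (intro sum.cong) auto
    finally show ?thesis .
  qed
  moreover have "0 < h j" if "j < d" for j
    using that unfolding h_def d by (intro sum_pos) (auto intro: w)
  moreover have "0 < poly g x" if "\<theta> < x" for x
    unfolding g_def poly_sum poly_smult
    using that by (intro sum_pos) (auto intro!: mult_pos_pos w pos)
  ultimately show thesis using that \<open>0 < c\<close> by blast
qed

end

section \<open>Polynomials of the adjacency matrix\<close>

lemma sum_diff_singleton_twice:
  fixes \<phi> :: "'a \<Rightarrow> real"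
  assumes "finite e" "y \<in> e"
  shows "(\<Sum>w\<in>e - {y}. \<Sum>v\<in>e - {w}. \<phi> v)
    = (real (card e) - 1) * \<phi> y + (real (card e) - 2) * (\<Sum>v\<in>e - {y}. \<phi> v)"
proof -
  have card: "real (card (e - {y})) = real (card e) - 1"
    using assms by (simp add: card_Diff_singleton of_nat_diff card_gt_0_iff Suc_leI)
      (metis One_nat_def Suc_leI card_gt_0_iff empty_iff of_nat_1 of_nat_diff)
  have "(\<Sum>w\<in>e - {y}. \<Sum>v\<in>e - {w}. \<phi> v) = (\<Sum>w\<in>e - {y}. sum \<phi> e - \<phi> w)"
    using assms(1) by (intro sum.cong) (auto simp: sum_diff1)
  also have "\<dots> = (real (card e) - 1) * sum \<phi> e - (\<Sum>v\<in>e - {y}. \<phi> v)"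
    by (simp add: sum_subtractf card)
  also have "sum \<phi> e = \<phi> y + (\<Sum>v\<in>e - {y}. \<phi> v)"
    using assms by (simp add: sum.remove)
  finally show ?thesis by (simp add: algebra_simps)
qed

text \<open>The number of walks from \<open>x\<close> to \<open>y\<close> of length \<open>i\<close> whose consecutive edges differ and whose last
  edge is not \<open>e\<close>. As no edge is empty, \<open>e = {}\<close> imposes no restriction.\<close>

primrec nb_walks :: "'a set set \<Rightarrow> nat \<Rightarrow> 'a \<Rightarrow> 'a \<Rightarrow> 'a set \<Rightarrow> nat" where
  "nb_walks E 0 x y e = (if x = y then 1 else 0)"
| "nb_walks E (Suc i) x y e = (\<Sum>f | f \<in> E \<and> y \<in> f \<and> f \<noteq> e. \<Sum>w\<in>f - {y}. nb_walks E i x w f)"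

definition neighbours :: "'a set set \<Rightarrow> 'a \<Rightarrow> 'a set" where
  "neighbours E y = {w. w \<noteq> y \<and> (\<exists>e\<in>E. y \<in> e \<and> w \<in> e)}"

primrec num_walks :: "'a set set \<Rightarrow> nat \<Rightarrow> 'a \<Rightarrow> 'a \<Rightarrow> real" where
  "num_walks E 0 x y = (if x = y then 1 else 0)"
| "num_walks E (Suc m) x y = (\<Sum>z\<in>neighbours E y. num_walks E m x z)"

text \<open>The \<open>(x, y)\<close> entry of \<open>p(A)\<close>, where \<open>A\<close> is the adjacency matrix.\<close>

definition poly_entry :: "'a set set \<Rightarrow> real poly \<Rightarrow> 'a \<Rightarrow> 'a \<Rightarrow> real" where
  "poly_entry E p x y = (\<Sum>m\<le>degree p. coeff p m * num_walks E m x y)"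

lemma poly_entry_altdef:
  "degree p \<le> n \<Longrightarrow> poly_entry E p x y = (\<Sum>m\<le>n. coeff p m * num_walks E m x y)"
  unfolding poly_entry_def
  by (rule sum.mono_neutral_left) (auto simp: coeff_eq_0)

lemma poly_entry_0 [simp]: "poly_entry E 0 x y = 0"
  and poly_entry_1 [simp]: "poly_entry E 1 x y = (if x = y then 1 else 0)"
  by (simp_all add: poly_entry_def)

lemma poly_entry_add: "poly_entry E (p + p') x y = poly_entry E p x y + poly_entry E p' x y"
  using degree_add_le_max[of p p']
  by (simp add: poly_entry_altdef[of _ "max (degree p) (degree p')"] sum.distrib algebra_simps)

lemma poly_entry_smult: "poly_entry E (Polynomial.smult a p) x y = a * poly_entry E p x y"
  by (simp add: poly_entry_altdef[of _ "degree p"] sum_distrib_left mult.assoc)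

lemma poly_entry_diff: "poly_entry E (p - p') x y = poly_entry E p x y - poly_entry E p' x y"
  using poly_entry_add[of E p "- p'" x y] poly_entry_smult[of E "- 1" p' x y] by simp

lemma poly_entry_sum: "poly_entry E (\<Sum>i\<in>I. f i) x y = (\<Sum>i\<in>I. poly_entry E (f i) x y)"
  by (induction I rule: infinite_finite_induct) (simp_all add: poly_entry_add)

lemma poly_entry_pCons:
  "poly_entry E (pCons a p) x y
    = (if x = y then a else 0) + (\<Sum>z\<in>neighbours E y. poly_entry E p x z)"
proof -
  have "poly_entry E (pCons a p) x y
      = (\<Sum>m\<le>Suc (degree p). coeff (pCons a p) m * num_walks E m x y)"
    by (rule poly_entry_altdef) (simp add: degree_pCons_le)
  also have "\<dots> = (if x = y then a else 0)
      + (\<Sum>m\<le>degree p. \<Sum>z\<in>neighbours E y. coeff p m * num_walks E m x z)"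
    unfolding sum.atMost_Suc_shift by (simp add: sum_distrib_left)
  also have "(\<Sum>m\<le>degree p. \<Sum>z\<in>neighbours E y. coeff p m * num_walks E m x z)
      = (\<Sum>z\<in>neighbours E y. poly_entry E p x z)"
    unfolding poly_entry_def by (rule sum.swap)
  finally show ?thesis .
qed

locale ru_hyp = ru_params r u k q
  for r u :: nat and k q :: real +
  fixes V :: "'a::linorder set" and E :: "'a set set"
  assumes H: "ru_hypergraph r u V E"
begin

abbreviation "n \<equiv> card V"
abbreviation "nb \<equiv> neighbours E"
abbreviation "pe \<equiv> poly_entry E"
abbreviation "N i x y \<equiv> nb_walks E i x y {}"

lemma finite_V: "finite V" and V_ne: "V \<noteq> {}"
  and edge_sub: "e \<in> E \<Longrightarrow> e \<subseteq> V" and edge_card: "e \<in> E \<Longrightarrow> card e = u"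
  and edge_deg: "x \<in> V \<Longrightarrow> card {e \<in> E. x \<in> e} = r"
  using H by (auto simp: ru_hypergraph_def hypergraph_def uniform_hypergraph_def regular_hypergraph_def)

lemma finite_E: "finite E"
  using finite_V edge_sub by (meson PowI finite_Pow_iff finite_subset subsetI)

lemma finite_edge: "e \<in> E \<Longrightarrow> finite e"
  using finite_V edge_sub finite_subset by blast

lemma edge_ne: "e \<in> E \<Longrightarrow> e \<noteq> {}"
  using edge_card u2 by fastforce

lemma edges_eqI:
  assumes "e \<in> E" "f \<in> E" "x \<noteq> y" "x \<in> e" "y \<in> e" "x \<in> f" "y \<in> f"
  shows "e = f"
proof (rule ccontr)
  assume "e \<noteq> f"
  have "hwalk V E [x, y, x] [e, f]"
    using assms edge_sub[OF assms(1)] by (auto simp: hwalk_def less_Suc_eq)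
  then have "berge_cycle V E [x, y, x] [e, f]"
    using assms \<open>e \<noteq> f\<close> by (simp add: berge_cycle_def)
  then have "hypergraph_girth V E \<le> enat (length [e, f])"
    unfolding hypergraph_girth_def by (intro INF_lower) blast
  moreover have "3 \<le> hypergraph_girth V E" using H by (simp add: ru_hypergraph_def)
  ultimately have "(3::enat) \<le> enat (length [e, f])" by (rule order_trans[rotated])
  then show False by (simp add: numeral_eq_enat)
qed

lemma nb_sub: "nb y \<subseteq> V"
  using edge_sub by (auto simp: neighbours_def)

lemma finite_nb: "finite (nb y)"
  using nb_sub finite_V finite_subset by blast

lemma nb_sym: "z \<in> nb y \<longleftrightarrow> y \<in> nb z"
  by (auto simp: neighbours_def)

lemma sum_edges_nb:
  fixes \<phi> :: "'a \<Rightarrow> 'b::comm_monoid_add"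
  shows "(\<Sum>f | f \<in> E \<and> y \<in> f. \<Sum>w\<in>f - {y}. \<phi> w) = (\<Sum>w\<in>nb y. \<phi> w)"
proof -
  have "nb y = (\<Union>f\<in>{f \<in> E. y \<in> f}. f - {y})"
    by (auto simp: neighbours_def)
  then have "(\<Sum>w\<in>nb y. \<phi> w) = (\<Sum>w\<in>(\<Union>f\<in>{f \<in> E. y \<in> f}. f - {y}). \<phi> w)" by simp
  also have "\<dots> = (\<Sum>f\<in>{f \<in> E. y \<in> f}. \<Sum>w\<in>f - {y}. \<phi> w)"
  proof (rule sum.UNION_disjoint)
    show "\<forall>i\<in>{f \<in> E. y \<in> f}. \<forall>j\<in>{f \<in> E. y \<in> f}. i \<noteq> j \<longrightarrow> (i - {y}) \<inter> (j - {y}) = {}"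
      using edges_eqI by blast
  qed (use finite_E finite_edge in auto)
  finally show ?thesis by simp
qed

lemma card_edge_minus: "e \<in> E \<Longrightarrow> y \<in> e \<Longrightarrow> real (card (e - {y})) = real u - 1"
  using edge_card finite_edge u2 by (simp add: of_nat_diff)

lemma card_nb: "y \<in> V \<Longrightarrow> real (card (nb y)) = k"
proof -
  assume y: "y \<in> V"
  have "real (card (nb y)) = (\<Sum>w\<in>nb y. 1)" by simp
  also have "\<dots> = (\<Sum>f | f \<in> E \<and> y \<in> f. \<Sum>w\<in>f - {y}. (1::real))"
    by (rule sum_edges_nb[symmetric])
  also have "\<dots> = (\<Sum>f | f \<in> E \<and> y \<in> f. real u - 1)"
    by (intro sum.cong) (use card_edge_minus in auto)
  also have "\<dots> = k" using edge_deg[OF y] by (simp add: k_def)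
  finally show ?thesis .
qed

lemma N_1: "N (Suc 0) x y = (if x \<in> nb y then 1 else 0)"
proof -
  have "N (Suc 0) x y = (\<Sum>f | f \<in> E \<and> y \<in> f. \<Sum>w\<in>f - {y}. if x = w then 1 else 0)"
    using edge_ne by simp (intro sum.cong, auto)
  also have "\<dots> = (if x \<in> nb y then 1 else 0)"
    unfolding sum_edges_nb using finite_nb by simp
  finally show ?thesis .
qed

lemma N_Suc: "N (Suc i) x y = (\<Sum>f | f \<in> E \<and> y \<in> f. \<Sum>w\<in>f - {y}. nb_walks E i x w f)"
  using edge_ne by simp (intro sum.cong, auto)

lemma N_split:
  assumes "e \<in> E" "z \<in> e"
  shows "N (Suc i) x z = nb_walks E (Suc i) x z e + (\<Sum>w\<in>e - {z}. nb_walks E i x w e)"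
proof -
  have "{f. f \<in> E \<and> z \<in> f} = insert e {f. f \<in> E \<and> z \<in> f \<and> f \<noteq> e}"
    using assms by auto
  then show ?thesis
    using finite_E unfolding N_Suc by (simp add: add.commute)
qed

lemma N_rec_aux:
  assumes "y \<in> V"
  shows "real (N (Suc (Suc i)) x y)
    = (\<Sum>z\<in>nb y. real (N (Suc i) x z)) - (real u - 2) * real (N (Suc i) x y)
      - (real u - 1) * (\<Sum>f | f \<in> E \<and> y \<in> f. real (nb_walks E i x y f))"
proof -
  let ?E = "{f. f \<in> E \<and> y \<in> f}"
  have "real (N (Suc (Suc i)) x y)
      = (\<Sum>f\<in>?E. \<Sum>w\<in>f - {y}. real (N (Suc i) x w) - (\<Sum>v\<in>f - {w}. real (nb_walks E i x v f)))"
    unfolding N_Suc[of "Suc i"] of_nat_sum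
  proof (intro sum.cong refl)
    fix f w assume "f \<in> ?E" "w \<in> f - {y}"
    then show "real (nb_walks E (Suc i) x w f)
      = real (N (Suc i) x w) - (\<Sum>v\<in>f - {w}. real (nb_walks E i x v f))"
      using N_split[of f w i x] by simp
  qed
  also have "\<dots> = (\<Sum>z\<in>nb y. real (N (Suc i) x z))
      - (\<Sum>f\<in>?E. \<Sum>w\<in>f - {y}. \<Sum>v\<in>f - {w}. real (nb_walks E i x v f))"
    by (simp only: sum_subtractf sum_edges_nb)
  also have "(\<Sum>f\<in>?E. \<Sum>w\<in>f - {y}. \<Sum>v\<in>f - {w}. real (nb_walks E i x v f))
      = (\<Sum>f\<in>?E. (real u - 1) * real (nb_walks E i x y f)
          + (real u - 2) * (\<Sum>v\<in>f - {y}. real (nb_walks E i x v f)))"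
  proof (intro sum.cong refl)
    fix f assume "f \<in> ?E"
    then show "(\<Sum>w\<in>f - {y}. \<Sum>v\<in>f - {w}. real (nb_walks E i x v f))
      = (real u - 1) * real (nb_walks E i x y f) + (real u - 2) * (\<Sum>v\<in>f - {y}. real (nb_walks E i x v f))"
      using sum_diff_singleton_twice[of f y "\<lambda>v. real (nb_walks E i x v f)"] finite_edge edge_card
      by simp
  qed
  also have "\<dots> = (real u - 1) * (\<Sum>f\<in>?E. real (nb_walks E i x y f))
      + (real u - 2) * real (N (Suc i) x y)"
    unfolding N_Suc by (simp add: sum.distrib sum_distrib_left)
  finally show ?thesis by simp
qed

lemma N_2:
  assumes "y \<in> V"
  shows "real (N (Suc (Suc 0)) x y)
    = (\<Sum>z\<in>nb y. real (N (Suc 0) x z)) - (real u - 2) * real (N (Suc 0) x y) - k * real (N 0 x y)"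
  using edge_deg[OF assms] unfolding N_rec_aux[OF assms] by (simp add: k_def)

lemma N_rec:
  assumes "y \<in> V" "1 \<le> i"
  shows "real (N (Suc (Suc i)) x y)
    = (\<Sum>z\<in>nb y. real (N (Suc i) x z)) - (real u - 2) * real (N (Suc i) x y) - q * real (N i x y)"
proof -
  obtain j where i: "i = Suc j" using assms(2) by (cases i) auto
  have "(\<Sum>f | f \<in> E \<and> y \<in> f. real (nb_walks E i x y f))
      = (\<Sum>f | f \<in> E \<and> y \<in> f. real (N i x y) - (\<Sum>w\<in>f - {y}. real (nb_walks E j x w f)))"
    unfolding i
  proof (intro sum.cong refl)
    fix f assume "f \<in> {f. f \<in> E \<and> y \<in> f}"
    then show "real (nb_walks E (Suc j) x y f)
      = real (N (Suc j) x y) - (\<Sum>w\<in>f - {y}. real (nb_walks E j x w f))"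
      using N_split[of f y j x] by (simp del: nb_walks.simps)
  qed
  also have "\<dots> = (real r - 1) * real (N i x y)"
    using edge_deg[OF assms(1)] by (simp add: sum_subtractf i N_Suc algebra_simps del: nb_walks.simps)
  finally show ?thesis unfolding N_rec_aux[OF assms(1)] by (simp add: q_def)
qed

lemma pe_F: "y \<in> V \<Longrightarrow> pe (F i) x y = real (N i x y)"
proof (induction i arbitrary: y rule: less_induct)
  case (less i)
  have lin: "pe ([:a, 1:] * p) x y = a * pe p x y + (\<Sum>z\<in>nb y. pe p x z)" for a p
    by (simp add: poly_entry_add poly_entry_smult poly_entry_pCons)
  have nbV: "z \<in> V" if "z \<in> nb y" for z using that nb_sub by blast
  consider "i = 0" | "i = Suc 0" | "i = Suc (Suc 0)" | j where "i = Suc (Suc j)" "1 \<le> j"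
    by (metis One_nat_def Suc_le_eq not0_implies_Suc not_gr_zero)
  then show ?case
  proof cases
    case 1
    then show ?thesis by simp
  next
    case 2
    have "F (Suc 0) = pCons 0 1" by (simp add: one_pCons)
    then have "pe (F i) x y = (\<Sum>z\<in>nb y. if x = z then 1 else 0)"
      using 2 by (simp only: poly_entry_pCons poly_entry_1) simp
    then show ?thesis using finite_nb 2 N_1[of x y] by (simp del: nb_walks.simps)
  next
    case 3
    have "F i = [:- (real u - 2), 1:] * F (Suc 0) - Polynomial.smult k (F 0)"
      using 3 F_2 by (simp add: numeral_2_eq_2)
    then show ?thesis
      using less.prems nbV 3
      by (simp only: poly_entry_diff lin poly_entry_smult less.IH N_2)
        (simp add: less.IH algebra_simps del: F_poly.simps nb_walks.simps)
  next
    case 4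
    then show ?thesis
      using less.prems nbV
      by (simp only: F_rec poly_entry_diff lin poly_entry_smult N_rec)
        (simp add: less.IH algebra_simps del: F_poly.simps nb_walks.simps)
  qed
qed

lemma sum_nb_delta: "(\<Sum>z\<in>nb y. \<phi> z) = (\<Sum>z\<in>V. if z \<in> nb y then \<phi> z else (0::real))"
  using nb_sub[of y] finite_V by (simp add: sum.If_cases Int_absorb1 inf.absorb2)

lemma pe_mult: "x \<in> V \<Longrightarrow> y \<in> V \<Longrightarrow> pe (p * p') x y = (\<Sum>z\<in>V. pe p x z * pe p' z y)"
proof (induction p' arbitrary: y)
  case 0
  then show ?case by simp
next
  case (pCons a p')
  have nbV: "w \<in> V" if "w \<in> nb y" for w using that nb_sub by blast
  have "pe (p * pCons a p') x y = a * pe p x y + (\<Sum>w\<in>nb y. pe (p * p') x w)"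
    by (simp add: poly_entry_add poly_entry_smult poly_entry_pCons)
  also have "(\<Sum>w\<in>nb y. pe (p * p') x w) = (\<Sum>w\<in>nb y. \<Sum>z\<in>V. pe p x z * pe p' z w)"
    using pCons.IH pCons.prems nbV by (intro sum.cong) auto
  also have "\<dots> = (\<Sum>z\<in>V. pe p x z * (\<Sum>w\<in>nb y. pe p' z w))"
    by (subst sum.swap) (simp add: sum_distrib_left)
  also have "a * pe p x y = (\<Sum>z\<in>V. pe p x z * (if z = y then a else 0))"
    using finite_V pCons.prems by (simp add: sum.delta' if_distrib cong: if_cong)
  finally show ?case
    by (simp only: poly_entry_pCons distrib_left sum.distrib)
qed

lemma pe_sym: "x \<in> V \<Longrightarrow> y \<in> V \<Longrightarrow> pe p x y = pe p y x"
proof (induction p arbitrary: x y)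
  case 0
  then show ?case by simp
next
  case (pCons a p)
  have lin: "pe [:0, 1:] y z = (if z \<in> nb y then 1 else 0)" for z
    using finite_nb[of z] nb_sym[of y z] by (simp add: poly_entry_pCons)
  have "pe (pCons a p) y x = pe (Polynomial.smult a 1 + [:0, 1:] * p) y x"
    by (simp add: one_pCons)
  also have "\<dots> = (if x = y then a else 0) + (\<Sum>z\<in>V. (if z \<in> nb y then 1 else 0) * pe p z x)"
    using pe_mult[OF pCons.prems(2,1), of "[:0, 1:]" p]
    by (simp only: poly_entry_add poly_entry_smult lin) auto
  also have "(\<Sum>z\<in>V. (if z \<in> nb y then 1 else 0) * pe p z x) = (\<Sum>z\<in>V. (if z \<in> nb y then pe p x z else 0))"
    using pCons.IH pCons.prems by (intro sum.cong) auto
  finally show ?case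
    by (simp add: poly_entry_pCons sum_nb_delta)
qed

lemma pe_row_sum: "x \<in> V \<Longrightarrow> (\<Sum>y\<in>V. pe p x y) = poly p k"
proof (induction p)
  case 0
  then show ?case by simp
next
  case (pCons a p)
  have "(\<Sum>y\<in>V. \<Sum>z\<in>nb y. pe p x z) = (\<Sum>z\<in>V. \<Sum>y\<in>V. if y \<in> nb z then pe p x z else 0)"
    unfolding sum_nb_delta by (subst sum.swap) (intro sum.cong, auto simp: nb_sym)
  also have "\<dots> = (\<Sum>z\<in>V. k * pe p x z)"
    by (intro sum.cong refl) (simp flip: sum_nb_delta add: card_nb)
  also have "\<dots> = k * poly p k"
    using pCons by (simp flip: sum_distrib_left)
  finally show ?case
    using pCons.prems finite_V by (simp add: poly_entry_pCons sum.distrib)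
qed

abbreviation "vs \<equiv> sorted_list_of_set V"
abbreviation "M \<equiv> adjacency_matrix V E"
abbreviation "spec \<equiv> proots (char_poly M)"

lemma vs_bij: "bij_betw ((!) vs) {..<n} V"
  using bij_betw_nth[of vs "{..<n}" V] finite_V by simp

lemma vs_in: "i < n \<Longrightarrow> vs ! i \<in> V"
  using bij_betwE[OF vs_bij] by auto

lemma sum_vs: "(\<Sum>i<n. \<phi> (vs ! i)) = (\<Sum>x\<in>V. \<phi> x)"
  by (rule sum.reindex_bij_betw[OF vs_bij])

lemma M_carrier: "M \<in> carrier_mat n n"
  by (simp add: adjacency_matrix_def Let_def)

lemma card_common_edges:
  "x \<noteq> y \<Longrightarrow> card {e \<in> E. {x, y} \<subseteq> e} = (if x \<in> nb y then 1 else 0)"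
proof (cases "x \<in> nb y")
  case True
  assume "x \<noteq> y"
  from True obtain e where e: "e \<in> E" "x \<in> e" "y \<in> e" by (auto simp: neighbours_def)
  then have "{e \<in> E. {x, y} \<subseteq> e} = {e}" using edges_eqI \<open>x \<noteq> y\<close> by blast
  with True show ?thesis by simp
next
  case False
  assume "x \<noteq> y"
  with False have "{e \<in> E. {x, y} \<subseteq> e} = {}" by (auto simp: neighbours_def)
  then show ?thesis using False by (simp only: card.empty if_False)
qed

lemma M_entry: "i < n \<Longrightarrow> j < n \<Longrightarrow> M $$ (i, j) = (if vs ! i \<in> nb (vs ! j) then 1 else 0)"
  using card_common_edges[of "vs ! i" "vs ! j"]
  by (auto simp: adjacency_matrix_def Let_def neighbours_def)

lemma M_pow: "i < n \<Longrightarrow> j < n \<Longrightarrow> (M ^\<^sub>m m) $$ (i, j) = num_walks E m (vs ! i) (vs ! j)"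
proof (induction m arbitrary: j)
  case 0
  have "vs ! i = vs ! j \<longleftrightarrow> i = j"
    using 0 vs_bij by (auto simp: bij_betw_def inj_on_eq_iff)
  then show ?case using 0 M_carrier by auto
next
  case (Suc m)
  have "M ^\<^sub>m m \<in> carrier_mat n n" using M_carrier by simp
  then have "(M ^\<^sub>m Suc m) $$ (i, j) = (\<Sum>l<n. (M ^\<^sub>m m) $$ (i, l) * M $$ (l, j))"
    using M_carrier Suc.prems by (simp add: scalar_prod_def atLeast0LessThan)
  also have "\<dots> = (\<Sum>l<n. (if vs ! l \<in> nb (vs ! j) then num_walks E m (vs ! i) (vs ! l) else 0))"
    using Suc by (intro sum.cong) (auto simp: M_entry)
  also have "\<dots> = (\<Sum>z\<in>nb (vs ! j). num_walks E m (vs ! i) z)"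
    unfolding sum_nb_delta by (rule sum_vs)
  finally show ?case by simp
qed

lemma M_sym: "i < n \<Longrightarrow> j < n \<Longrightarrow> M $$ (i, j) = M $$ (j, i)"
  using nb_sym by (simp add: M_entry)

lemma spec_size: "size spec = n"
  by (rule proots_char_poly_real_symmetric(1)[OF M_carrier M_sym])

lemma trace_pe: "(\<Sum>x\<in>V. pe p x x) = (\<Sum>a\<in>#spec. poly p a)"
proof -
  have "(\<Sum>x\<in>V. num_walks E m x x) = (\<Sum>a\<in>#spec. a ^ m)" for m
  proof -
    have "(\<Sum>x\<in>V. num_walks E m x x) = (\<Sum>i<n. (M ^\<^sub>m m) $$ (i, i))"
      by (simp add: M_pow sum_vs[of "\<lambda>x. num_walks E m x x"])
    also have "\<dots> = (\<Sum>a\<in>#spec. a ^ m)"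
      by (rule proots_char_poly_real_symmetric(2)[OF M_carrier M_sym])
    finally show ?thesis .
  qed
  then have "(\<Sum>x\<in>V. pe p x x) = (\<Sum>m\<le>degree p. coeff p m * (\<Sum>a\<in>#spec. a ^ m))"
    unfolding poly_entry_def by (subst sum.swap) (simp flip: sum_distrib_left)
  also have "\<dots> = (\<Sum>a\<in>#spec. poly p a)"
  proof -
    have "(\<Sum>m\<le>degree p. coeff p m * (\<Sum>a\<in>#S. a ^ m)) = (\<Sum>a\<in>#S. poly p a)" for S
      by (induction S) (simp_all add: distrib_left sum.distrib poly_altdef)
    then show ?thesis .
  qed
  finally show ?thesis .
qed

lemma k_in_spec: "k \<in># spec"
proof -
  define v where "v = vec n (\<lambda>i. 1 :: real)"
  have "M *\<^sub>v v = k \<cdot>\<^sub>v v"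
  proof (rule eq_vecI)
    fix i assume "i < dim_vec (k \<cdot>\<^sub>v v)"
    then have i: "i < n" by (simp add: v_def)
    have "(M *\<^sub>v v) $ i = (\<Sum>j<n. M $$ (i, j))"
      using M_carrier i by (simp add: v_def scalar_prod_def atLeast0LessThan)
    also have "\<dots> = (\<Sum>j<n. if vs ! j \<in> nb (vs ! i) then 1 else 0)"
      using i by (intro sum.cong) (auto simp: M_entry nb_sym)
    also have "\<dots> = (\<Sum>z\<in>V. if z \<in> nb (vs ! i) then 1 else 0)" by (rule sum_vs)
    also have "\<dots> = k" using card_nb[OF vs_in[OF i]] by (simp flip: sum_nb_delta)
    finally show "(M *\<^sub>v v) $ i = (k \<cdot>\<^sub>v v) $ i" using i by (simp add: v_def)
  qed (use M_carrier in \<open>simp add: v_def\<close>)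
  moreover have "v \<noteq> 0\<^sub>v n"
  proof
    assume "v = 0\<^sub>v n"
    moreover have "0 < n" using finite_V V_ne by (simp add: card_gt_0_iff)
    ultimately show False using index_vec[of 0 n "\<lambda>i. 1 :: real"] by (simp add: v_def)
  qed
  ultimately have "eigenvalue M k"
    using M_carrier unfolding eigenvalue_def eigenvector_def by (intro exI[of _ v]) (auto simp: v_def)
  then have "poly (char_poly M) k = 0" using eigenvalue_root_char_poly[OF M_carrier] by blast
  moreover have "char_poly M \<noteq> 0" using degree_monic_char_poly[OF M_carrier] by auto
  ultimately show ?thesis by simp
qed

lemma n_ge_2: "2 \<le> n"
proof -
  obtain x where "x \<in> V" using V_ne by blast
  then have "{e \<in> E. x \<in> e} \<noteq> {}" using edge_deg[of x] r2 by (metis card.empty not_numeral_le_zero)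
  then obtain e where e: "e \<in> E" by blast
  then show ?thesis using card_mono[OF finite_V edge_sub[OF e]] edge_card[OF e] u2 by simp
qed

lemma second_eigenvalue_le_iff:
  assumes "\<theta> < k"
  shows "second_eigenvalue V E \<le> \<theta> \<longleftrightarrow> (\<forall>a\<in>#spec - {#k#}. a \<le> \<theta>)"
proof -
  define L where "L = rev (sorted_list_of_multiset spec)"
  have mset: "mset L = spec" by (simp add: L_def)
  have "length L = n" using spec_size by (metis mset size_mset)
  then obtain a b l where L: "L = a # b # l"
    using n_ge_2 by (metis (no_types, opaque_lifting) One_nat_def Suc_1 Suc_le_length_iff)
  have "sorted (rev L)" by (simp add: L_def)
  then have ord: "b \<le> a" "\<forall>z\<in>set l. z \<le> b"
    unfolding L by (auto simp: sorted_append)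
  have second: "second_eigenvalue V E = b"
    by (simp add: second_eigenvalue_def L flip: L_def)
  show ?thesis
  proof
    assume "second_eigenvalue V E \<le> \<theta>"
    then have le: "\<forall>z\<in>set (b # l). z \<le> \<theta>" using ord second by auto
    moreover have "k \<in> set L" using k_in_spec by (simp flip: mset)
    ultimately have "a = k" using assms L by fastforce
    then have "spec - {#k#} = mset (b # l)" by (simp flip: mset add: L)
    with le show "\<forall>a\<in>#spec - {#k#}. a \<le> \<theta>" by (metis set_mset_mset)
  next
    assume le: "\<forall>a\<in>#spec - {#k#}. a \<le> \<theta>"
    show "second_eigenvalue V E \<le> \<theta>"
    proof (rule ccontr)
      assume "\<not> second_eigenvalue V E \<le> \<theta>"
      then have gt: "\<theta> < a" "\<theta> < b" using second ord by auto
      have "a \<in># spec - {#k#} \<or> b \<in># spec - {#k#}"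
        unfolding mset[symmetric] L by (cases "k = a") auto
      with le gt show False by auto
    qed
  qed
qed

end

section \<open>The bound on the order\<close>

lemma sum_mset_real_nonneg: "(\<And>a. a \<in># S \<Longrightarrow> 0 \<le> f a) \<Longrightarrow> 0 \<le> (\<Sum>a\<in>#S. f a :: real)"
  by (induction S) auto

lemma sum_mset_real_nonneg_eq_0:
  assumes "\<And>a. a \<in># S \<Longrightarrow> 0 \<le> f a" and "(\<Sum>a\<in>#S. f a :: real) = 0" and "b \<in># S"
  shows "f b = 0"
proof -
  have "(\<Sum>a\<in>#S. f a) = f b + (\<Sum>a\<in>#S - {#b#}. f a)"
    using assms(3) by (metis insert_DiffM image_mset_add_mset sum_mset.add_mset)
  moreover have "0 \<le> (\<Sum>a\<in>#S - {#b#}. f a)"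
    using assms(1) by (intro sum_mset_real_nonneg) (meson in_diffD)
  ultimately show ?thesis using assms(1)[OF assms(3)] assms(2) by linarith
qed

context ru_hyp begin

abbreviation "nontrivial_spec \<equiv> spec - {#k#}"

lemma trace_split: "(\<Sum>x\<in>V. pe p x x) = poly p k + (\<Sum>a\<in>#nontrivial_spec. poly p a)"
  unfolding trace_pe using k_in_spec
  by (metis insert_DiffM image_mset_add_mset sum_mset.add_mset)

lemma trace_mult: "(\<Sum>x\<in>V. pe (p * p') x x) = (\<Sum>x\<in>V. \<Sum>y\<in>V. pe p x y * pe p' x y)"
  by (intro sum.cong refl) (auto simp: pe_mult pe_sym intro!: sum.cong)

lemma pe_G: "y \<in> V \<Longrightarrow> pe (G i) x y = (\<Sum>j\<le>i. real (N j x y))"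
  by (simp add: G_poly_def poly_entry_sum pe_F)

context
  fixes d :: nat and c \<theta> :: real
  assumes d1: "1 \<le> d" and lz_lt: "lz (d - 1) < ereal \<theta>" and lz_ge: "ereal \<theta> \<le> lz d"
    and c_def: "c = - (poly (F d) \<theta> / poly (G (d - 1)) \<theta>)"
    and \<theta>_k: "\<theta> < k"
begin

definition "P = F d + Polynomial.smult c (G (d - 1))"

lemma pe_P: "y \<in> V \<Longrightarrow> pe P x y = real (N d x y) + c * (\<Sum>j<d. real (N j x y))"
proof -
  have "{..d - 1} = {..<d}" using d1 by auto
  then show "y \<in> V \<Longrightarrow> pe P x y = real (N d x y) + c * (\<Sum>j<d. real (N j x y))"
    by (simp add: P_def poly_entry_add poly_entry_smult pe_F pe_G)
qed

lemma c_pos: "0 < c"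
  by (rule moore_polynomial[OF d1 lz_lt lz_ge c_def])

lemma P_k: "poly P k / c = 1 + (\<Sum>j<d - 1. k * q ^ j) + k * q ^ (d - 1) / c"
  using c_pos d1 poly_F_k[of "d - 1"] by (simp add: P_def poly_G_k field_simps del: F_poly.simps)

lemma trace_lower_bound:
  assumes g: "g = (\<Sum>j<d. Polynomial.smult (h j) (F j))" and h: "\<And>j. j < d \<Longrightarrow> 0 < h j"
  shows "c * real n * poly g k \<le> (\<Sum>x\<in>V. pe (P * g) x x)"
proof -
  have pe_g: "pe g x y = (\<Sum>j<d. h j * real (N j x y))" if "y \<in> V" for x y
    using that by (simp add: g poly_entry_sum poly_entry_smult pe_F)
  have "c * pe g x y \<le> pe P x y * pe g x y" if "y \<in> V" for x y
  proof -
    have "c * real (N j x y) \<le> pe P x y * real (N j x y)" if "j < d" for j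
    proof (cases "N j x y = 0")
      case False
      have "real (N j x y) \<le> (\<Sum>j<d. real (N j x y))"
        using \<open>j < d\<close> by (intro member_le_sum) auto
      then have "c * 1 \<le> c * (\<Sum>j<d. real (N j x y))"
        using False c_pos by (intro mult_left_mono) linarith+
      then have "c \<le> pe P x y" using pe_P[OF \<open>y \<in> V\<close>, of x] by linarith
      then show ?thesis by (intro mult_right_mono) auto
    qed simp
    then have "(\<Sum>j<d. h j * (c * real (N j x y))) \<le> (\<Sum>j<d. h j * (pe P x y * real (N j x y)))"
      using h by (intro sum_mono mult_left_mono) (auto intro: less_imp_le)
    then show ?thesis using that by (simp add: pe_g sum_distrib_left mult_ac)
  qed
  then have "(\<Sum>x\<in>V. \<Sum>y\<in>V. c * pe g x y) \<le> (\<Sum>x\<in>V. \<Sum>y\<in>V. pe P x y * pe g x y)"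
    by (intro sum_mono)
  moreover have "(\<Sum>x\<in>V. \<Sum>y\<in>V. c * pe g x y) = c * real n * poly g k"
    by (simp add: pe_row_sum flip: sum_distrib_left)
  ultimately show ?thesis by (simp add: trace_mult)
qed

lemma order_bound:
  assumes "second_eigenvalue V E \<le> \<theta>"
  shows "real n \<le> poly P k / c"
    and "real n = poly P k / c \<Longrightarrow> a \<in># nontrivial_spec \<Longrightarrow> poly P a = 0"
proof -
  obtain g h where P: "P = [:- \<theta>, 1:] * g" and g: "g = (\<Sum>j<d. Polynomial.smult (h j) (F j))"
    and h: "\<And>j. j < d \<Longrightarrow> 0 < h j" and g_pos: "\<And>x. \<theta> < x \<Longrightarrow> 0 < poly g x"
    unfolding P_def by (rule moore_polynomial[OF d1 lz_lt lz_ge c_def]) blast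
  have val: "- poly (P * g) a = (\<theta> - a) * (poly g a)\<^sup>2" for a
    by (simp add: P power2_eq_square algebra_simps)
  have nonneg: "0 \<le> - poly (P * g) a" if "a \<in># nontrivial_spec" for a
    unfolding val using assms second_eigenvalue_le_iff[OF \<theta>_k] that by (intro mult_nonneg_nonneg) auto
  have sum: "c * real n * poly g k + (\<Sum>a\<in>#nontrivial_spec. - poly (P * g) a) \<le> poly P k * poly g k"
  proof -
    have "(\<Sum>a\<in>#S. - poly (P * g) a) = - (\<Sum>a\<in>#S. poly (P * g) a)" for S
      by (induction S) auto
    then show ?thesis using trace_lower_bound[OF g h] trace_split[of "P * g"] by simp
  qed
  have gk: "0 < poly g k" using g_pos[OF \<theta>_k] .
  have sum_nonneg: "0 \<le> (\<Sum>a\<in>#nontrivial_spec. - poly (P * g) a)"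
    by (rule sum_mset_real_nonneg) (rule nonneg)
  have "c * real n * poly g k \<le> poly P k * poly g k" using sum sum_nonneg by linarith
  then have "c * real n \<le> poly P k" using gk by simp
  then show "real n \<le> poly P k / c" using c_pos by (simp add: field_simps)
  show "poly P a = 0" if n: "real n = poly P k / c" and a: "a \<in># nontrivial_spec"
  proof -
    have "c * real n = poly P k" using n c_pos by simp
    then have "(\<Sum>a\<in>#nontrivial_spec. - poly (P * g) a) = 0" using sum sum_nonneg by simp
    from sum_mset_real_nonneg_eq_0[OF nonneg this a] show ?thesis
      unfolding val by (auto simp: P)
  qed
qed

text \<open>\<open>tr P(A)\<^sup>2 = P(k)\<^sup>2\<close> and the row sums of \<open>P(A)\<close> are \<open>P(k)\<close>, so the variance of the
  entries of \<open>P(A)\<close> vanishes.\<close>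

lemma pe_P_const:
  assumes "second_eigenvalue V E \<le> \<theta>" and n: "real n = poly P k / c" and "x \<in> V" "y \<in> V"
  shows "pe P x y = c"
proof -
  have nc: "poly P k = c * real n" using n c_pos by simp
  have "(\<Sum>a\<in>#nontrivial_spec. poly (P * P) a) = (\<Sum>a\<in>#nontrivial_spec. 0)"
    using order_bound(2)[OF assms(1) n] by (intro arg_cong[of _ _ sum_mset] image_mset_cong) simp
  then have sq: "(\<Sum>x\<in>V. \<Sum>y\<in>V. pe P x y * pe P x y) = (poly P k)\<^sup>2"
    using trace_split[of "P * P"] by (simp add: trace_mult power2_eq_square)
  have "(\<Sum>x\<in>V. \<Sum>y\<in>V. (pe P x y - c)\<^sup>2)
      = (\<Sum>x\<in>V. \<Sum>y\<in>V. pe P x y * pe P x y) - 2 * c * (\<Sum>x\<in>V. \<Sum>y\<in>V. pe P x y) + (c * real n)\<^sup>2"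
    by (simp add: power2_eq_square algebra_simps sum.distrib sum_subtractf sum_distrib_left)
  also have "\<dots> = 0"
    by (simp add: sq pe_row_sum nc power2_eq_square)
  finally have "(\<Sum>x\<in>V. \<Sum>y\<in>V. (pe P x y - c)\<^sup>2) = 0" .
  then have "(\<Sum>y\<in>V. (pe P x y - c)\<^sup>2) = 0"
    using assms(3) finite_V by (subst (asm) sum_nonneg_eq_0_iff) (auto intro: sum_nonneg)
  then have "(pe P x y - c)\<^sup>2 = 0"
    using assms(4) finite_V by (subst (asm) sum_nonneg_eq_0_iff) auto
  then show ?thesis by simp
qed

lemma order_eq_if_pe_P_const:
  assumes const: "\<And>x y. x \<in> V \<Longrightarrow> y \<in> V \<Longrightarrow> pe P x y = c"
  shows "real n = poly P k / c" and "second_eigenvalue V E \<le> \<theta>"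
proof -
  obtain x where "x \<in> V" using V_ne by blast
  then have Pk: "poly P k = c * real n"
    using pe_row_sum[of x P] const by (simp add: mult.commute)
  then show "real n = poly P k / c" using c_pos by simp
  obtain g h where P: "P = [:- \<theta>, 1:] * g" and "g = (\<Sum>j<d. Polynomial.smult (h j) (F j))"
    and "\<And>j. j < d \<Longrightarrow> 0 < h j" and g_pos: "\<And>x. \<theta> < x \<Longrightarrow> 0 < poly g x"
    unfolding P_def by (rule moore_polynomial[OF d1 lz_lt lz_ge c_def]) blast
  have "(\<Sum>x\<in>V. pe (P * P) x x) = poly (P * P) k"
    unfolding trace_mult using const by (simp add: Pk)
  then have "(\<Sum>a\<in>#nontrivial_spec. poly (P * P) a) = 0"
    using trace_split[of "P * P"] by simp
  then have zero: "poly (P * P) a = 0" if "a \<in># nontrivial_spec" for a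
    using that by (rule sum_mset_real_nonneg_eq_0[rotated]) simp
  have "a \<le> \<theta>" if "a \<in># nontrivial_spec" for a
  proof (rule ccontr)
    assume "\<not> a \<le> \<theta>"
    with zero[OF that] g_pos[of a] show False by (simp add: P)
  qed
  then show "second_eigenvalue V E \<le> \<theta>" using second_eigenvalue_le_iff[OF \<theta>_k] by blast
qed

end

end

section \<open>Distances and shortest paths\<close>

lemma vwalk_snoc:
  "p \<noteq> [] \<Longrightarrow> vwalk (p @ [y]) G \<longleftrightarrow> vwalk p G \<and> y \<in> verts G \<and> (last p, y) \<in> arcs_ends G"
  by (auto simp: vwalk_def vwalk_arcs_append)

lemma graph_dist_le: "vwalk p G \<Longrightarrow> hd p = x \<Longrightarrow> last p = y \<Longrightarrow> graph_dist G x y \<le> enat (vwalk_length p)"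
  unfolding graph_dist_def by (intro INF_lower) blast

lemma graph_dist_attained:
  assumes "graph_dist G x y = enat i"
  obtains p where "vwalk p G" "hd p = x" "last p = y" "vwalk_length p = i"
proof -
  let ?A = "(\<lambda>p. enat (vwalk_length p)) ` {p. vwalk p G \<and> hd p = x \<and> last p = y}"
  have inf: "Inf ?A = enat i" using assms by (simp add: graph_dist_def)
  then have "?A \<noteq> {}" by (metis Inf_enat_def enat.distinct(2))
  then have "Inf ?A \<in> ?A"
    unfolding Inf_enat_def by (auto intro: LeastI)
  then show thesis using that inf by auto
qed

context ru_hyp begin

abbreviation "\<Gamma> \<equiv> point_graph V E"
abbreviation "gd \<equiv> graph_dist \<Gamma>"

lemma verts_\<Gamma>: "verts \<Gamma> = V"
  by (simp add: point_graph_def)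

lemma arcs_\<Gamma>: "(y, z) \<in> arcs_ends \<Gamma> \<longleftrightarrow> z \<in> nb y"
  using edge_sub by (auto simp: point_graph_def neighbours_def)

lemma dist_self: "x \<in> V \<Longrightarrow> gd x x = 0"
  using graph_dist_le[of "[x]" \<Gamma> x x] by (simp add: vwalk_def verts_\<Gamma> zero_enat_def[symmetric])

lemma dist_0_iff: "x \<in> V \<Longrightarrow> gd x y = 0 \<longleftrightarrow> x = y"
proof
  assume "gd x y = 0"
  then obtain p where "vwalk p \<Gamma>" "hd p = x" "last p = y" "vwalk_length p = 0"
    by (metis graph_dist_attained zero_enat_def)
  then show "x = y" by (cases p) (auto simp: vwalk_def)
qed (auto simp: dist_self)

lemma dist_Suc_le: "z \<in> nb y \<Longrightarrow> gd x z \<le> enat i \<Longrightarrow> gd x y \<le> enat (Suc i)"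
proof -
  assume z: "z \<in> nb y" and "gd x z \<le> enat i"
  then obtain j where j: "gd x z = enat j" "j \<le> i" using enat_ile by force
  then obtain p where p: "vwalk p \<Gamma>" "hd p = x" "last p = z" "vwalk_length p = j"
    by (metis graph_dist_attained)
  then have ne: "p \<noteq> []" by (auto simp: vwalk_def)
  have "y \<in> V" using z nb_sub nb_sym by blast
  then have "vwalk (p @ [y]) \<Gamma>"
    using p z nb_sym by (simp add: vwalk_snoc[OF ne] verts_\<Gamma> arcs_\<Gamma>)
  then have "gd x y \<le> enat (vwalk_length (p @ [y]))"
    using p ne by (intro graph_dist_le) auto
  also have "\<dots> = enat (Suc j)" using p ne by (cases p) auto
  also have "\<dots> \<le> enat (Suc i)" using j by simp
  finally show ?thesis .
qed

lemma dist_Suc_obtain: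
  assumes "gd x y = enat (Suc i)"
  obtains z where "z \<in> nb y" "gd x z \<le> enat i"
proof -
  from assms obtain p where p: "vwalk p \<Gamma>" "hd p = x" "last p = y" "vwalk_length p = Suc i"
    by (metis graph_dist_attained)
  then obtain p' where p': "p = p' @ [y]" "p' \<noteq> []"
    by (cases p rule: rev_cases) force+
  then have "vwalk p' \<Gamma>" "last p' \<in> nb y"
    using p nb_sym by (auto simp: vwalk_snoc arcs_\<Gamma>)
  moreover have "gd x (last p') \<le> enat (vwalk_length p')"
    using p p' \<open>vwalk p' \<Gamma>\<close> by (intro graph_dist_le) auto
  ultimately show thesis using that p p' by auto
qed

lemma nb_walks_le: "nb_walks E i x y e \<le> N i x y"
proof (cases i)
  case (Suc j)
  show ?thesis unfolding Suc N_Suc nb_walks.simps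
    by (rule sum_mono2) (use finite_E in auto)
qed simp

lemma N_neighbour_sum:
  assumes "y \<in> V"
  shows "(\<Sum>z\<in>nb y. real (N i x z)) = real (N (Suc i) x y)
    + (if i = 0 then 0
       else (real u - 2) * real (N i x y) + (if i = 1 then k else q) * real (N (i - 1) x y))"
proof -
  consider "i = 0" | "i = Suc 0" | j where "i = Suc j" "1 \<le> j"
    by (metis One_nat_def Suc_le_eq not0_implies_Suc not_gr_zero)
  then show ?thesis
  proof cases
    case 1
    have "(\<Sum>z\<in>nb y. N 0 x z) = (if x \<in> nb y then 1 else 0)" using finite_nb by simp
    then show ?thesis using N_1[of x y] 1 by (simp flip: of_nat_sum del: nb_walks.simps)
  next
    case 2
    then show ?thesis using N_2[OF assms, of x] by (simp del: nb_walks.simps)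
  next
    case 3
    then show ?thesis using N_rec[OF assms 3(2), of x] by (simp del: nb_walks.simps)
  qed
qed

lemma dist_le_if_N_pos: "x \<in> V \<Longrightarrow> y \<in> V \<Longrightarrow> 0 < N i x y \<Longrightarrow> gd x y \<le> enat i"
proof (induction i arbitrary: y)
  case 0
  then show ?case by (auto simp: dist_self split: if_splits)
next
  case (Suc i)
  then have "N (Suc i) x y \<noteq> 0" by simp
  then have "\<exists>f\<in>{f. f \<in> E \<and> y \<in> f}. \<exists>w\<in>f - {y}. nb_walks E i x w f \<noteq> 0"
    unfolding N_Suc by (meson sum.neutral)
  then obtain f w where f: "f \<in> E" "y \<in> f" "w \<in> f" "w \<noteq> y" "0 < nb_walks E i x w f" by auto
  then have "w \<in> nb y" by (auto simp: neighbours_def)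
  moreover have "gd x w \<le> enat i"
    using Suc f nb_walks_le[of i x w f] edge_sub[OF f(1)] by (intro Suc.IH) auto
  ultimately show ?case by (rule dist_Suc_le)
qed

lemma ex_N_pos: "x \<in> V \<Longrightarrow> y \<in> V \<Longrightarrow> gd x y \<le> enat j \<Longrightarrow> \<exists>i\<le>j. 0 < N i x y"
proof (induction j arbitrary: y)
  case 0
  then have "x = y" using dist_0_iff[of x y] by (simp flip: zero_enat_def)
  then show ?case by simp
next
  case (Suc j)
  show ?case
  proof (cases "gd x y \<le> enat j")
    case True
    then show ?thesis using Suc le_SucI by blast
  next
    case False
    with Suc.prems(3) have "gd x y = enat (Suc j)"
      by (metis Suc_ile_eq enat_ord_simps(2) leI order_antisym)
    then obtain z where z: "z \<in> nb y" "gd x z \<le> enat j" by (rule dist_Suc_obtain)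
    then obtain i where i: "i \<le> j" "0 < N i x z" using Suc nb_sub by blast
    have "0 < (\<Sum>z\<in>nb y. real (N i x z))"
      using z(1) i(2) finite_nb by (intro sum_pos2[of _ z]) auto
    then have "N (Suc i) x y \<noteq> 0 \<or> N i x y \<noteq> 0 \<or> N (i - 1) x y \<noteq> 0"
      unfolding N_neighbour_sum[OF Suc.prems(2)] by (auto simp del: nb_walks.simps split: if_splits intro!: gr0I)
    moreover have "Suc i \<le> Suc j" "i \<le> Suc j" "i - 1 \<le> Suc j" using i(1) by auto
    ultimately show ?thesis by blast
  qed
qed

lemma dist_N:
  assumes "x \<in> V" "y \<in> V" "gd x y = enat j"
  shows "0 < N j x y" and "i < j \<Longrightarrow> N i x y = 0"
proof -
  have zero: "N i x y = 0" if "i < j" for i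
    using dist_le_if_N_pos[OF assms(1,2), of i] that assms(3) by force
  then show "i < j \<Longrightarrow> N i x y = 0" .
  obtain i where "i \<le> j" "0 < N i x y" using ex_N_pos[OF assms(1,2), of j] assms(3) by auto
  with zero[of i] show "0 < N j x y" by (cases "i = j") auto
qed

lemma shortest_paths_Suc:
  assumes "x \<in> V" "y \<in> V" and dist: "gd x y = enat (Suc j)"
  shows "shortest_paths \<Gamma> x y
    = (\<Union>z\<in>{z \<in> nb y. gd x z = enat j}. (\<lambda>p. p @ [y]) ` shortest_paths \<Gamma> x z)"
proof (intro equalityI subsetI)
  fix p assume "p \<in> shortest_paths \<Gamma> x y"
  then have p: "vwalk p \<Gamma>" "distinct p" "hd p = x" "last p = y" "vwalk_length p = Suc j"
    using dist by (auto simp: shortest_paths_def vpath_def)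
  then obtain p' where p': "p = p' @ [y]" "p' \<noteq> []"
    by (cases p rule: rev_cases) force+
  let ?z = "last p'"
  have w: "vwalk p' \<Gamma>" "?z \<in> nb y"
    using p p' nb_sym by (auto simp: vwalk_snoc arcs_\<Gamma>)
  have len: "vwalk_length p' = j" using p p' by simp
  have le: "gd x ?z \<le> enat j"
    using p p' w len graph_dist_le[of p' \<Gamma> x ?z] by auto
  then obtain i where i: "gd x ?z = enat i" "i \<le> j" using enat_ile by force
  then have "enat (Suc j) \<le> enat (Suc i)" using dist_Suc_le[OF w(2), of x i] dist by simp
  then have z: "gd x ?z = enat j" using i by simp
  then have "p' \<in> shortest_paths \<Gamma> x ?z"
    using p p' w len by (auto simp: shortest_paths_def vpath_def)
  then show "p \<in> (\<Union>z\<in>{z \<in> nb y. gd x z = enat j}. (\<lambda>p. p @ [y]) ` shortest_paths \<Gamma> x z)"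
    using p' w z by blast
next
  fix p assume "p \<in> (\<Union>z\<in>{z \<in> nb y. gd x z = enat j}. (\<lambda>p. p @ [y]) ` shortest_paths \<Gamma> x z)"
  then obtain z p' where z: "z \<in> nb y" "gd x z = enat j" and p: "p = p' @ [y]"
    and "p' \<in> shortest_paths \<Gamma> x z" by blast
  then have p': "vwalk p' \<Gamma>" "distinct p'" "hd p' = x" "last p' = z" "vwalk_length p' = j"
    by (auto simp: shortest_paths_def vpath_def)
  have ne: "p' \<noteq> []" using p' by (auto simp: vwalk_def)
  have "y \<notin> set p'"
  proof
    assume "y \<in> set p'"
    then obtain a b where ab: "p' = (a @ [y]) @ b" using split_list by fastforce
    have "vwalk (a @ [y]) \<Gamma>"
      using p'(1) set_vwalk_arcs_append1[of "a @ [y]" b] unfolding ab vwalk_def by auto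
    then have "gd x y \<le> enat (vwalk_length (a @ [y]))"
      using p'(3) unfolding ab by (intro graph_dist_le) (auto simp: hd_append)
    also have "\<dots> \<le> enat j" using p'(5) unfolding ab by simp
    finally show False using dist by simp
  qed
  moreover have "vwalk p \<Gamma>"
    using p' z nb_sym assms(2) unfolding p by (simp add: vwalk_snoc[OF ne] verts_\<Gamma> arcs_\<Gamma>)
  moreover have "vwalk_length p = Suc j" using p' ne unfolding p by (cases p') auto
  ultimately show "p \<in> shortest_paths \<Gamma> x y"
    using p' ne dist unfolding p by (auto simp: shortest_paths_def vpath_def)
qed

lemma shortest_paths_N:
  "x \<in> V \<Longrightarrow> y \<in> V \<Longrightarrow> gd x y = enat j
    \<Longrightarrow> finite (shortest_paths \<Gamma> x y) \<and> card (shortest_paths \<Gamma> x y) = N j x y"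
proof (induction j arbitrary: y)
  case 0
  then have xy: "x = y" and d0: "gd x x = 0"
    using dist_0_iff[of x y] dist_self by (simp_all flip: zero_enat_def)
  have "p \<in> shortest_paths \<Gamma> x x \<longleftrightarrow> p = [x]" for p
  proof -
    have "length p - 1 = 0 \<and> p \<noteq> [] \<and> hd p = x \<longleftrightarrow> p = [x]"
      by (cases p) auto
    then show ?thesis
      using 0(1) d0 by (auto simp: shortest_paths_def vpath_def vwalk_def verts_\<Gamma> zero_enat_def)
  qed
  then have "shortest_paths \<Gamma> x y = {[x]}" using xy by blast
  then show ?case using xy by simp
next
  case (Suc j)
  let ?Z = "{z \<in> nb y. gd x z = enat j}"
  have finZ: "finite ?Z" using finite_nb by simp
  have IH: "finite (shortest_paths \<Gamma> x z) \<and> card (shortest_paths \<Gamma> x z) = N j x z" if "z \<in> ?Z" for z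
    using that nb_sub Suc by blast
  note eq = shortest_paths_Suc[OF Suc.prems]
  have "card (shortest_paths \<Gamma> x y) = (\<Sum>z\<in>?Z. card ((\<lambda>p. p @ [y]) ` shortest_paths \<Gamma> x z))"
    unfolding eq
  proof (rule card_UN_disjoint[OF finZ])
    show "\<forall>z\<in>?Z. \<forall>z'\<in>?Z. z \<noteq> z' \<longrightarrow>
      (\<lambda>p. p @ [y]) ` shortest_paths \<Gamma> x z \<inter> (\<lambda>p. p @ [y]) ` shortest_paths \<Gamma> x z' = {}"
      by (auto simp: shortest_paths_def)
  qed (use IH in blast)
  also have "\<dots> = (\<Sum>z\<in>?Z. N j x z)"
    using IH by (intro sum.cong refl) (subst card_image, auto simp: inj_on_def)
  also have "\<dots> = (\<Sum>z\<in>nb y. N j x z)"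
  proof (rule sum.mono_neutral_left)
    show "\<forall>z\<in>nb y - ?Z. N j x z = 0"
    proof
      fix z assume z: "z \<in> nb y - ?Z"
      show "N j x z = 0"
      proof (rule ccontr)
        assume "N j x z \<noteq> 0"
        then have "gd x z \<le> enat j" using z nb_sub Suc.prems(1) by (intro dist_le_if_N_pos) auto
        then obtain i where i: "gd x z = enat i" "i \<le> j" using enat_ile by force
        then have "enat (Suc j) \<le> enat (Suc i)" using dist_Suc_le[of z y x i] z Suc.prems(3) by simp
        with i z show False by simp
      qed
    qed
  qed (use finite_nb in auto)
  finally have "real (card (shortest_paths \<Gamma> x y)) = (\<Sum>z\<in>nb y. real (N j x z))" by simp
  also have "\<dots> = real (N (Suc j) x y)"
    unfolding N_neighbour_sum[OF Suc.prems(2)] using dist_N(2)[OF Suc.prems] by (simp del: nb_walks.simps)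
  finally have "card (shortest_paths \<Gamma> x y) = N (Suc j) x y" by linarith
  moreover have "finite (shortest_paths \<Gamma> x y)" unfolding eq using finZ IH by blast
  ultimately show ?case by blast
qed

end

section \<open>Generalized Moore geometries\<close>

context ru_hyp begin

definition nb_at :: "'a \<Rightarrow> 'a \<Rightarrow> nat \<Rightarrow> real" where
  "nb_at x y i = real (card {z. (y, z) \<in> arcs_ends \<Gamma> \<and> gd x z = enat i})"

lemma nb_at_sum: "nb_at x y i = (\<Sum>z\<in>nb y. if gd x z = enat i then 1 else 0)"
proof -
  have "{z. (y, z) \<in> arcs_ends \<Gamma> \<and> gd x z = enat i} = {z \<in> nb y. gd x z = enat i}"
    by (simp add: arcs_\<Gamma>)
  then show ?thesis using finite_nb by (simp add: nb_at_def sum.If_cases Int_def)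
qed

lemma nb_at_far:
  assumes "gd x y = enat j" and "Suc i < j \<or> Suc j < i"
  shows "nb_at x y i = 0"
  unfolding nb_at_sum
proof (rule sum.neutral, rule ballI)
  fix z assume z: "z \<in> nb y"
  have "gd x z \<noteq> enat i"
  proof
    assume i: "gd x z = enat i"
    have "enat j \<le> enat (Suc i)" using dist_Suc_le[OF z, of x i] i assms(1) by simp
    moreover have "enat i \<le> enat (Suc j)"
      using dist_Suc_le[of y z x j] z nb_sym i assms(1) by simp
    ultimately show False using assms(2) by simp
  qed
  then show "(if gd x z = enat i then 1 else 0 :: real) = 0" by simp
qed

context
  fixes d :: nat and c \<theta> :: real
  assumes d1: "1 \<le> d" and lz_lt: "lz (d - 1) < ereal \<theta>" and lz_ge: "ereal \<theta> \<le> lz d"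
    and c_def: "c = - (poly (F d) \<theta> / poly (G (d - 1)) \<theta>)"
    and \<theta>_k: "\<theta> < k"
begin

abbreviation "array_c \<equiv> (\<lambda>i. if i < d then 1 else c)"
abbreviation "array_a \<equiv> (\<lambda>i. if i = 0 then 0 else if i < d then real u - 2 else k - c)"
abbreviation "array_b \<equiv> (\<lambda>i. if i = 0 then k else q)"
abbreviation "Pol \<equiv> P d c"

lemmas pe_Pol = pe_P[OF d1 lz_lt lz_ge c_def \<theta>_k]
  and c_gt0 = c_pos[OF d1 lz_lt lz_ge c_def \<theta>_k]

lemma array_imp_N:
  assumes array: "distance_regular_with_array \<Gamma> d array_c array_a array_b"
    and "x \<in> V" "y \<in> V" "i \<le> d"
  shows "real (N i x y) = (if gd x y = enat i then array_c i else 0)"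
proof -
  have "gd x y \<le> enat d" if "x \<in> V" "y \<in> V" for x y
  proof -
    have "gd x y \<le> graph_diameter \<Gamma>"
      unfolding graph_diameter_def verts_\<Gamma> using that by (meson SUP_upper order_trans)
    then show ?thesis using array by (simp add: distance_regular_with_array_def)
  qed
  then have dist: "\<exists>j\<le>d. gd x y = enat j" if "x \<in> V" "y \<in> V" for x y
    using that enat_ile by (metis enat_ord_simps(1))
  have arr: "(1 \<le> j \<longrightarrow> nb_at x y (j - 1) = array_c j) \<and> nb_at x y j = array_a j
      \<and> (j < d \<longrightarrow> nb_at x y (j + 1) = array_b j)"
    if "x \<in> V" "y \<in> V" "j \<le> d" "gd x y = enat j" for x y j
    using array that unfolding distance_regular_with_array_def verts_\<Gamma> nb_at_def by blast
  show ?thesis using assms(2-4)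
  proof (induction i arbitrary: y rule: less_induct)
    case (less i)
    note xy = less.prems(1,2)
    show ?case
    proof (cases i)
      case 0
      then show ?thesis using dist_0_iff[OF xy(1), of y] d1 by (simp flip: zero_enat_def)
    next
      case (Suc i')
      obtain j where j: "j \<le> d" "gd x y = enat j" using dist xy by blast
      have IH: "real (N i' x z) = (if gd x z = enat i' then 1 else 0)" if "z \<in> V" for z
        using less.IH[of i' z] that less.prems Suc by simp
      have "(\<Sum>z\<in>nb y. real (N i' x z)) = nb_at x y i'"
        unfolding nb_at_sum
      proof (intro sum.cong refl)
        fix z assume "z \<in> nb y"
        then have "z \<in> V" using nb_sub by blast
        then show "real (N i' x z) = (if gd x z = enat i' then 1 else 0)" by (rule IH)
      qed
      then have eq: "real (N i x y) = nb_at x y i' - (if i' = 0 then 0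
         else (real u - 2) * real (N i' x y) + (if i' = 1 then k else q) * real (N (i' - 1) x y))"
        using N_neighbour_sum[OF xy(2), of i' x] Suc by simp
      have N1: "real (N i' x y) = (if j = i' then 1 else 0)"
        using IH[OF xy(2)] j by simp
      have N2: "real (N (i' - 1) x y) = (if j = i' - 1 then 1 else 0)" if "i' \<noteq> 0"
        using less.IH[of "i' - 1" y] that less.prems Suc j by simp
      consider "j = Suc i'" | "j = i'" | "Suc j = i'" | "Suc i' < j" | "Suc j < i'" by linarith
      then show ?thesis
      proof cases
        case 1
        then show ?thesis using arr[OF xy j] j eq N1 N2 Suc by simp
      next
        case 2
        then show ?thesis using arr[OF xy j] j eq N1 N2 Suc less.prems(3) by auto
      next
        case 3
        then show ?thesis using arr[OF xy j] j eq N1 N2 Suc less.prems(3) by auto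
      next
        case 4
        then show ?thesis using nb_at_far[OF j(2), of i'] j eq N1 N2 Suc by simp
      next
        case 5
        then show ?thesis using nb_at_far[OF j(2), of i'] j eq N1 N2 Suc by auto
      qed
    qed
  qed
qed

lemma array_imp_pe_const:
  assumes array: "distance_regular_with_array \<Gamma> d array_c array_a array_b"
    and xy: "x \<in> V" "y \<in> V"
  shows "pe Pol x y = c"
proof -
  have "gd x y \<le> graph_diameter \<Gamma>"
    unfolding graph_diameter_def verts_\<Gamma> using xy by (meson SUP_upper order_trans)
  then have "gd x y \<le> enat d" using array by (simp add: distance_regular_with_array_def)
  then obtain j where j: "j \<le> d" "gd x y = enat j" using enat_ile by force
  note N = array_imp_N[OF array xy]
  have "(\<Sum>i<d. real (N i x y)) = (\<Sum>i<d. if i = j then 1 else 0)"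
    using N j by (intro sum.cong) auto
  also have "\<dots> = (if j < d then 1 else 0)" by simp
  finally show ?thesis
    using N[of d] j by (simp add: pe_Pol[OF xy(2)])
qed

context
  assumes const: "\<And>x y. x \<in> V \<Longrightarrow> y \<in> V \<Longrightarrow> pe Pol x y = c"
begin

lemma N_exclusive:
  assumes xy: "x \<in> V" "y \<in> V" and "i < d" "0 < N i x y"
  shows "N i x y = 1" and "j \<le> d \<Longrightarrow> j \<noteq> i \<Longrightarrow> N j x y = 0"
proof -
  let ?S = "\<Sum>j<d. N j x y"
  have eq: "real (N d x y) + c * real ?S = c"
    using const[OF xy] pe_Pol[OF xy(2), of x] by simp
  have le: "N i x y \<le> ?S" using assms(3) by (intro member_le_sum) auto
  have "c * real ?S \<le> c * 1" using eq by simp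
  then have "real ?S \<le> 1" using c_gt0 mult_le_cancel_left_pos by blast
  then have S: "?S = 1" using le assms(4) by linarith
  then have Nd: "N d x y = 0" using eq by simp
  show N1: "N i x y = 1" using le S assms(4) by linarith
  show "N j x y = 0" if j: "j \<le> d" "j \<noteq> i"
  proof (cases "j = d")
    case False
    have "?S = N i x y + (\<Sum>j\<in>{..<d} - {i}. N j x y)"
      using assms(3) by (simp add: sum.remove)
    then have "(\<Sum>j\<in>{..<d} - {i}. N j x y) = 0" using S N1 by linarith
    then show ?thesis using j False by (subst (asm) sum_eq_0_iff) auto
  qed (use Nd in simp)
qed

lemma dist_le_d: "x \<in> V \<Longrightarrow> y \<in> V \<Longrightarrow> \<exists>j\<le>d. gd x y = enat j"
proof -
  assume xy: "x \<in> V" "y \<in> V"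
  have "\<exists>i\<le>d. 0 < N i x y"
  proof (rule ccontr)
    assume "\<not> ?thesis"
    then have "real (N d x y) + c * (\<Sum>j<d. real (N j x y)) = 0" by simp
    then show False using const[OF xy] pe_Pol[OF xy(2), of x] c_gt0 by simp
  qed
  then obtain i where "i \<le> d" "gd x y \<le> enat i" using dist_le_if_N_pos xy by blast
  then show ?thesis using enat_ile by (metis enat_ord_simps(1) order_trans)
qed

lemma N_eq:
  assumes xy: "x \<in> V" "y \<in> V" and "i \<le> d"
  shows "real (N i x y) = (if gd x y = enat i then array_c i else 0)"
proof -
  obtain j where j: "j \<le> d" "gd x y = enat j" using dist_le_d[OF xy] by blast
  have pos: "0 < N j x y" by (rule dist_N(1)[OF xy j(2)])
  show ?thesis
  proof (cases "j < d")
    case True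
    show ?thesis
      using N_exclusive(1)[OF xy True pos] N_exclusive(2)[OF xy True pos, of i] assms(3) j True by (cases "i = j") auto
  next
    case False
    then have jd: "j = d" using j by simp
    have zero: "N i x y = 0" if "i < d" for i using dist_N(2)[OF xy j(2)] that jd by blast
    then have "real (N d x y) = c" using const[OF xy] pe_Pol[OF xy(2), of x] by simp
    then show ?thesis using zero j jd assms(3) by (cases "i = d") auto
  qed
qed

lemma diameter_d: "graph_diameter \<Gamma> = enat d"
proof (rule antisym)
  show "graph_diameter \<Gamma> \<le> enat d"
    unfolding graph_diameter_def verts_\<Gamma> using dist_le_d by (intro SUP_least) force
  obtain x where x: "x \<in> V" using V_ne by blast
  obtain e where e: "d = Suc e" using d1 by (cases d) auto
  have "(\<Sum>y\<in>V. pe (F d) x y) = k * q ^ e" using pe_row_sum[OF x] poly_F_k e by simp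
  moreover have "0 < k" using q_ge_1 u2 by (simp add: k_eq)
  ultimately have "(\<Sum>y\<in>V. pe (F d) x y) \<noteq> 0" using q_ge_1 by simp
  then obtain y where y: "y \<in> V" "pe (F d) x y \<noteq> 0" by (meson sum.neutral)
  then have "real (N d x y) \<noteq> 0" by (simp add: pe_F)
  then have "gd x y = enat d" using N_eq[OF x y(1), of d] by (auto split: if_splits)
  moreover have "gd x y \<le> graph_diameter \<Gamma>"
    unfolding graph_diameter_def verts_\<Gamma> using x y by (meson SUP_upper order_trans)
  ultimately show "enat d \<le> graph_diameter \<Gamma>" by simp
qed

lemma nb_at_lt:
  assumes xy: "x \<in> V" "y \<in> V" and j: "j \<le> d" "gd x y = enat j" and "i < d"
  shows "nb_at x y i = (if j = Suc i then array_c j else if j = i then array_a j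
    else if Suc j = i then array_b j else 0)"
proof -
  have "nb_at x y i = (\<Sum>z\<in>nb y. real (N i x z))"
    unfolding nb_at_sum
  proof (intro sum.cong refl)
    fix z assume "z \<in> nb y"
    then have "z \<in> V" using nb_sub by blast
    then show "(if gd x z = enat i then 1 else 0) = real (N i x z)"
      using N_eq[OF xy(1), of z i] assms(5) by simp
  qed
  also have "\<dots> = real (N (Suc i) x y) + (if i = 0 then 0
       else (real u - 2) * real (N i x y) + (if i = 1 then k else q) * real (N (i - 1) x y))"
    by (rule N_neighbour_sum[OF xy(2)])
  also have "\<dots> = (if j = Suc i then array_c j else if j = i then array_a j
    else if Suc j = i then array_b j else 0)"
    using N_eq[OF xy, of "Suc i"] N_eq[OF xy, of i] N_eq[OF xy, of "i - 1"] j assms(5)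
    by (auto simp del: nb_walks.simps)
  finally show ?thesis .
qed

lemma nb_at_d:
  assumes xy: "x \<in> V" "y \<in> V"
  shows "nb_at x y d = k - (\<Sum>i<d. nb_at x y i)"
proof -
  have "(\<Sum>i\<le>d. nb_at x y i) = (\<Sum>z\<in>nb y. \<Sum>i\<le>d. if gd x z = enat i then 1 else 0)"
    unfolding nb_at_sum by (rule sum.swap)
  also have "\<dots> = (\<Sum>z\<in>nb y. 1)"
  proof (rule sum.cong[OF refl])
    fix z assume "z \<in> nb y"
    then obtain j where "j \<le> d" "gd x z = enat j" using dist_le_d[OF xy(1)] nb_sub by blast
    then show "(\<Sum>i\<le>d. if gd x z = enat i then 1 else 0) = (1 :: real)" by simp
  qed
  also have "\<dots> = k" using card_nb[OF xy(2)] by simp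
  finally show ?thesis by (simp flip: lessThan_Suc_atMost)
qed

lemma distance_regular_if_pe_const:
  "distance_regular_with_array \<Gamma> d array_c array_a array_b"
proof -
  have "(1 \<le> j \<longrightarrow> nb_at x y (j - 1) = array_c j) \<and> nb_at x y j = array_a j
      \<and> (j < d \<longrightarrow> nb_at x y (j + 1) = array_b j)"
    if xy: "x \<in> V" "y \<in> V" and j: "j \<le> d" "gd x y = enat j" for x y j
  proof (intro conjI impI)
    note lt = nb_at_lt[OF xy j]
    show "nb_at x y (j - 1) = array_c j" if "1 \<le> j" using lt[of "j - 1"] that j by simp
    have sum: "(\<Sum>i<d. nb_at x y i) = (\<Sum>i<d. if i = j - 1 \<and> 1 \<le> j then array_c j else 0)
        + (\<Sum>i<d. if i = j then array_a j else 0)" if "d \<le> Suc j"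
      unfolding sum.distrib[symmetric] using lt that by (intro sum.cong) auto
    have sum': "(\<Sum>i<d. nb_at x y i) = (if 1 \<le> j then array_c j else 0)
        + (if j < d then array_a j else 0)" if "d \<le> Suc j"
      unfolding sum[OF that] using j d1 by (cases j) auto
    show "nb_at x y j = array_a j"
    proof (cases "j < d")
      case True
      then show ?thesis using lt[of j] by simp
    next
      case False
      then show ?thesis using sum' nb_at_d[OF xy] j d1 by simp
    qed
    show "nb_at x y (j + 1) = array_b j" if "j < d"
    proof (cases "Suc j < d")
      case True
      then show ?thesis using lt[of "Suc j"] by simp
    next
      case False
      then have "d = Suc j" using that by simp
      then show ?thesis using sum' nb_at_d[OF xy] by (simp add: k_eq)
    qed
  qed
  then show ?thesis
    unfolding distance_regular_with_array_def verts_\<Gamma> using diameter_d by (simp flip: nb_at_def)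
qed

lemma moore_geometry_if_pe_const: "generalized_moore_geometry r u d V E"
  unfolding generalized_moore_geometry_def
proof (intro conjI ballI impI H diameter_d)
  fix x y assume xy: "x \<in> V" "y \<in> V" and lt: "x \<noteq> y \<and> gd x y < enat d"
  then obtain j where j: "gd x y = enat j" "j < d" using dist_le_d[OF xy] by auto
  have "card (shortest_paths \<Gamma> x y) = 1"
    using shortest_paths_N[OF xy j(1)] N_eq[OF xy, of j] j by simp
  then show "\<exists>!p. p \<in> shortest_paths \<Gamma> x y" by (metis card_1_singletonE singletonI singletonD)
next
  have "real (card (shortest_paths \<Gamma> x y)) = c" if "x \<in> V" "y \<in> V" "gd x y = enat d" for x y
    using shortest_paths_N[OF that] N_eq[OF that(1,2), of d] that(3) by simp
  then have "card (shortest_paths \<Gamma> x y) = nat \<lfloor>c\<rfloor>" if "x \<in> V" "y \<in> V" "gd x y = enat d" for x y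
    using that by (metis floor_of_nat nat_int)
  then show "\<exists>c. \<forall>x\<in>V. \<forall>y\<in>V. gd x y = enat d \<longrightarrow> card (shortest_paths \<Gamma> x y) = c" by blast
qed

end

end

end

lemma Sup_card_eq_iff_attained:
  fixes M :: real and \<P> :: "nat set \<Rightarrow> nat set set \<Rightarrow> bool"
  defines "S \<equiv> {ereal (real (card V)) | V E. \<P> V E}"
  assumes bound: "\<And>V E. \<P> V E \<Longrightarrow> real (card V) \<le> M"
  shows "Sup S \<le> ereal M" and "Sup S = ereal M \<longleftrightarrow> (\<exists>V E. \<P> V E \<and> real (card V) = M)"
proof -
  show le: "Sup S \<le> ereal M"
    using bound by (intro Sup_least) (auto simp: S_def)
  show "Sup S = ereal M \<longleftrightarrow> (\<exists>V E. \<P> V E \<and> real (card V) = M)"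
  proof
    assume sup: "Sup S = ereal M"
    define C where "C = {card V | V E. \<P> V E}"
    have S_C: "S = (\<lambda>m. ereal (real m)) ` C" by (auto simp: S_def C_def)
    have "C \<noteq> {}" using sup by (auto simp: S_C bot_ereal_def)
    moreover have "finite C"
    proof (rule finite_subset)
      show "C \<subseteq> {..nat \<lfloor>M\<rfloor>}" using bound by (auto simp: C_def le_nat_floor)
    qed simp
    ultimately have "Sup S \<in> S"
      unfolding S_C by (metis Max_Sup Max_in finite_imageI image_is_empty)
    then show "\<exists>V E. \<P> V E \<and> real (card V) = M" using sup by (auto simp: S_def)
  next
    assume "\<exists>V E. \<P> V E \<and> real (card V) = M"
    then have "ereal M \<in> S" by (auto simp: S_def)
    with le show "Sup S = ereal M" by (meson Sup_upper antisym)
  qed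
qed

theorem theorem6p3:
  fixes r u :: nat and k q \<theta> :: real
  assumes "2 \<le> r" and "2 \<le> u"
    and "k = real r * (real u - 1)"
    and "q = (real r - 1) * (real u - 1)"
    and "-1 \<le> \<theta>" and "\<theta> < real u - 2 + 2 * sqrt q"
  shows
    "(\<exists>d::nat. 1 \<le> d \<and>
        largest_zero_G r u (d - 1) < ereal \<theta> \<and> ereal \<theta> \<le> largest_zero_G r u d) \<and>
     (\<forall>(d::nat) (c::real) (M::real). 1 \<le> d \<longrightarrow>
        largest_zero_G r u (d - 1) < ereal \<theta> \<longrightarrow> ereal \<theta> \<le> largest_zero_G r u d \<longrightarrow>
        c = - (poly (F_poly r u d) \<theta> / poly (G_poly r u (d - 1)) \<theta>) \<longrightarrow>
        M = 1 + (\<Sum>j<d - 1. k * q ^ j) + k * q ^ (d - 1) / c \<longrightarrow>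
        max_order r u \<theta> \<le> ereal M \<and>
        (max_order r u \<theta> = ereal M \<longleftrightarrow>
          (\<exists>(V::nat set) E. generalized_moore_geometry r u d V E \<and>
             distance_regular_with_array (point_graph V E) d
               (\<lambda>i. if i < d then 1 else c)
               (\<lambda>i. if i = 0 then 0 else if i < d then real u - 2 else k - c)
               (\<lambda>i. if i = 0 then k else q))))"
proof -
  interpret ru_params r u k q using assms by unfold_locales
  show ?thesis
  proof (intro conjI allI impI)
    show "\<exists>d::nat. 1 \<le> d \<and>
        largest_zero_G r u (d - 1) < ereal \<theta> \<and> ereal \<theta> \<le> largest_zero_G r u d"
      using ex_interval[OF assms(6)] by blast
  next
    fix d :: nat and c M :: real
    assume d: "1 \<le> d" "largest_zero_G r u (d - 1) < ereal \<theta>" "ereal \<theta> \<le> largest_zero_G r u d"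
      "c = - (poly (F_poly r u d) \<theta> / poly (G_poly r u (d - 1)) \<theta>)"
      and M: "M = 1 + (\<Sum>j<d - 1. k * q ^ j) + k * q ^ (d - 1) / c"
    note ctx = d theta_less_k[OF assms(6)]
    let ?Q = "\<lambda>(V::nat set) E. ru_hypergraph r u V E \<and> second_eigenvalue V E \<le> \<theta>"
    let ?A = "\<lambda>(V::nat set) E. generalized_moore_geometry r u d V E \<and>
             distance_regular_with_array (point_graph V E) d
               (\<lambda>i. if i < d then 1 else c)
               (\<lambda>i. if i = 0 then 0 else if i < d then real u - 2 else k - c)
               (\<lambda>i. if i = 0 then k else q)"
    have bound: "real (card V) \<le> M" if "?Q V E" for V E
    proof -
      interpret ru_hyp r u k q V E using that by unfold_locales auto
      show ?thesis using order_bound(1)[OF ctx] that unfolding P_k[OF ctx] M by blast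
    qed
    have eq: "?Q V E \<and> real (card V) = M \<longleftrightarrow> ?A V E" for V E
    proof
      assume Q: "?Q V E \<and> real (card V) = M"
      interpret ru_hyp r u k q V E using Q by unfold_locales auto
      have const: "pe (P d c) x y = c" if "x \<in> V" "y \<in> V" for x y
        using pe_P_const[OF ctx] that Q unfolding P_k[OF ctx] M by blast
      show "?A V E"
        using moore_geometry_if_pe_const[OF ctx const] distance_regular_if_pe_const[OF ctx const] by blast
    next
      assume A: "?A V E"
      then have H: "ru_hypergraph r u V E" by (simp add: generalized_moore_geometry_def)
      interpret ru_hyp r u k q V E using H by unfold_locales
      have const: "pe (P d c) x y = c" if "x \<in> V" "y \<in> V" for x y
        using array_imp_pe_const[OF ctx _ that] A by blast
      show "?Q V E \<and> real (card V) = M"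
        using order_eq_if_pe_P_const[OF ctx const] H unfolding P_k[OF ctx] M by blast
    qed
    note sup = Sup_card_eq_iff_attained[of ?Q, OF bound, folded max_order_def]
    show "max_order r u \<theta> \<le> ereal M" by (rule sup(1))
    show "max_order r u \<theta> = ereal M \<longleftrightarrow> (\<exists>V E. ?A V E)"
      using sup(2) eq by simp
  qed
qed

end
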